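(* Let $R$ be a commutative Noetherian ring and let $X$ be an $R$-module. Then the following conditions are equivalent. (1) Every $R$-submodule of $X$ is a trace module in $X$. (2) Every cyclic $R$-submodule of $X$ is a trace module in $X$. (3) There is an injective $R$-linear map $X \to \bigoplus_{\mathfrak m \in \operatorname{Max} R} \mathrm{E}_R(R/\mathfrak m)$, where for each $\mathfrak m\in \operatorname{Max} R$, $\mathrm{E}_R(R/\mathfrak m)$ denotes the injective envelope of the $R$-module $R/\mathfrak m$.
   Context: For $R$-modules $M$ and $X$, let $\tau_{M,X}: \operatorname{Hom}_R(M,X)\otimes_R M \to X$ be the $R$-linear map with $\tau_{M,X}(f\otimes m)=f(m)$, and let $\tau_X(M)=\operatorname{Im}\tau_{M,X}$, an $R$-submodule of $X$. An $R$-submodule $Y$ of $X$ is called a trace module in $X$ if $Y=\tau_X(M)$ for some $R$-module $M$. $\operatorname{Max} R$ denotes the set of maximal ideals of $R$. *)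

theory Defs
  imports "HOL-Algebra.Module" "HOL-Algebra.Ring_Divisibility"
begin

section \<open>Homomorphisms of modules\<close>

text \<open>Module homomorphisms are taken to be extensional, so that equality of homomorphisms is
  equality of functions. The fields \<open>mult\<close> and \<open>one\<close> of the record type of modules
  play no role in the locale \<open>module\<close>; they are left undefined in the constructions below.\<close>

definition mod_hom ::
    "('a, 'r) ring_scheme \<Rightarrow> ('a, 'b, 'm) module_scheme \<Rightarrow> ('a, 'c, 'n) module_scheme \<Rightarrow> ('b \<Rightarrow> 'c) set"
  where "mod_hom R M N =
    {f \<in> carrier M \<rightarrow>\<^sub>E carrier N.
      (\<forall>x\<in>carrier M. \<forall>y\<in>carrier M. f (x \<oplus>\<^bsub>M\<^esub> y) = f x \<oplus>\<^bsub>N\<^esub> f y) \<and>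
      (\<forall>a\<in>carrier R. \<forall>x\<in>carrier M. f (a \<odot>\<^bsub>M\<^esub> x) = a \<odot>\<^bsub>N\<^esub> f x)}"

definition hom_module ::
    "('a, 'r) ring_scheme \<Rightarrow> ('a, 'b, 'm) module_scheme \<Rightarrow> ('a, 'c, 'n) module_scheme \<Rightarrow> ('a, 'b \<Rightarrow> 'c) module"
  where "hom_module R M N =
    \<lparr>carrier = mod_hom R M N, monoid.mult = undefined, one = undefined,
     ring.zero = (\<lambda>x\<in>carrier M. \<zero>\<^bsub>N\<^esub>),
     ring.add = (\<lambda>f g. \<lambda>x\<in>carrier M. f x \<oplus>\<^bsub>N\<^esub> g x),
     smult = (\<lambda>a f. \<lambda>x\<in>carrier M. a \<odot>\<^bsub>N\<^esub> f x)\<rparr>"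


section \<open>Quotients, direct sums and tensor products\<close>

definition self_module :: "('a, 'r) ring_scheme \<Rightarrow> ('a, 'a) module"
  where "self_module R =
    \<lparr>carrier = carrier R, monoid.mult = undefined, one = undefined,
     ring.zero = \<zero>\<^bsub>R\<^esub>, ring.add = (\<oplus>\<^bsub>R\<^esub>), smult = (\<otimes>\<^bsub>R\<^esub>)\<rparr>"

definition quot_module :: "('a, 'b, 'm) module_scheme \<Rightarrow> 'b set \<Rightarrow> ('a, 'b set) module"
  where "quot_module M H =
    \<lparr>carrier = a_rcosets\<^bsub>M\<^esub> H, monoid.mult = undefined, one = undefined,
     ring.zero = H, ring.add = (<+>\<^bsub>M\<^esub>), smult = (\<lambda>a C. \<Union>x\<in>C. H +>\<^bsub>M\<^esub> (a \<odot>\<^bsub>M\<^esub> x))\<rparr>"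

definition direct_sum :: "'i set \<Rightarrow> ('i \<Rightarrow> ('a, 'b, 'm) module_scheme) \<Rightarrow> ('a, 'i \<Rightarrow> 'b) module"
  where "direct_sum I M =
    \<lparr>carrier = {x \<in> \<Pi>\<^sub>E i\<in>I. carrier (M i). finite {i \<in> I. x i \<noteq> \<zero>\<^bsub>M i\<^esub>}},
     monoid.mult = undefined, one = undefined,
     ring.zero = (\<lambda>i\<in>I. \<zero>\<^bsub>M i\<^esub>),
     ring.add = (\<lambda>x y. \<lambda>i\<in>I. x i \<oplus>\<^bsub>M i\<^esub> y i),
     smult = (\<lambda>a x. \<lambda>i\<in>I. a \<odot>\<^bsub>M i\<^esub> x i)\<rparr>"

abbreviation free_module :: "('a, 'r) ring_scheme \<Rightarrow> 'i set \<Rightarrow> ('a, 'i \<Rightarrow> 'a) module"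
  where "free_module R S \<equiv> direct_sum S (\<lambda>_. self_module R)"

definition free_basis :: "('a, 'r) ring_scheme \<Rightarrow> 'i set \<Rightarrow> 'i \<Rightarrow> 'i \<Rightarrow> 'a"
  where "free_basis R S p = (\<lambda>q\<in>S. if q = p then \<one>\<^bsub>R\<^esub> else \<zero>\<^bsub>R\<^esub>)"

text \<open>The tensor product is the free module on the pairs modulo the submodule generated by the
  relations of bilinearity.\<close>

definition tensor_free ::
    "('a, 'r) ring_scheme \<Rightarrow> ('a, 'b, 'm) module_scheme \<Rightarrow> ('a, 'c, 'n) module_scheme
      \<Rightarrow> ('a, 'b \<times> 'c \<Rightarrow> 'a) module"
  where "tensor_free R M N = free_module R (carrier M \<times> carrier N)"

definition tensor_rels ::
    "('a, 'r) ring_scheme \<Rightarrow> ('a, 'b, 'm) module_scheme \<Rightarrow> ('a, 'c, 'n) module_scheme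
      \<Rightarrow> ('b \<times> 'c \<Rightarrow> 'a) set"
  where "tensor_rels R M N =
    (let F = tensor_free R M N; b = (\<lambda>x y. free_basis R (carrier M \<times> carrier N) (x, y)) in
      {b (x \<oplus>\<^bsub>M\<^esub> x') y \<ominus>\<^bsub>F\<^esub> (b x y \<oplus>\<^bsub>F\<^esub> b x' y) |x x' y.
         x \<in> carrier M \<and> x' \<in> carrier M \<and> y \<in> carrier N} \<union>
      {b x (y \<oplus>\<^bsub>N\<^esub> y') \<ominus>\<^bsub>F\<^esub> (b x y \<oplus>\<^bsub>F\<^esub> b x y') |x y y'.
         x \<in> carrier M \<and> y \<in> carrier N \<and> y' \<in> carrier N} \<union>
      {b (a \<odot>\<^bsub>M\<^esub> x) y \<ominus>\<^bsub>F\<^esub> (a \<odot>\<^bsub>F\<^esub> b x y) |a x y.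
         a \<in> carrier R \<and> x \<in> carrier M \<and> y \<in> carrier N} \<union>
      {b x (a \<odot>\<^bsub>N\<^esub> y) \<ominus>\<^bsub>F\<^esub> (a \<odot>\<^bsub>F\<^esub> b x y) |a x y.
         a \<in> carrier R \<and> x \<in> carrier M \<and> y \<in> carrier N})"

definition tensor_ker ::
    "('a, 'r) ring_scheme \<Rightarrow> ('a, 'b, 'm) module_scheme \<Rightarrow> ('a, 'c, 'n) module_scheme
      \<Rightarrow> ('b \<times> 'c \<Rightarrow> 'a) set"
  where "tensor_ker R M N = (\<lambda>H. submodule H R (tensor_free R M N)) hull tensor_rels R M N"

definition tensor_module ::
    "('a, 'r) ring_scheme \<Rightarrow> ('a, 'b, 'm) module_scheme \<Rightarrow> ('a, 'c, 'n) module_scheme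
      \<Rightarrow> ('a, ('b \<times> 'c \<Rightarrow> 'a) set) module"
  where "tensor_module R M N = quot_module (tensor_free R M N) (tensor_ker R M N)"

definition pure_tensor ::
    "('a, 'r) ring_scheme \<Rightarrow> ('a, 'b, 'm) module_scheme \<Rightarrow> ('a, 'c, 'n) module_scheme
      \<Rightarrow> 'b \<Rightarrow> 'c \<Rightarrow> ('b \<times> 'c \<Rightarrow> 'a) set"
  where "pure_tensor R M N x y =
    tensor_ker R M N +>\<^bsub>tensor_free R M N\<^esub> free_basis R (carrier M \<times> carrier N) (x, y)"


section \<open>Trace modules\<close>

text \<open>The map \<open>\<tau>\<^bsub>M,X\<^esub>\<close> exists and is unique by lemma \<open>trace_map_ex1\<close> below.\<close>

definition trace_map ::
    "('a, 'r) ring_scheme \<Rightarrow> ('a, 'b, 'm) module_scheme \<Rightarrow> ('a, 'c, 'n) module_scheme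
      \<Rightarrow> (('b \<Rightarrow> 'c) \<times> 'b \<Rightarrow> 'a) set \<Rightarrow> 'c"
  where "trace_map R M V =
    (THE t. t \<in> mod_hom R (tensor_module R (hom_module R M V) M) V \<and>
       (\<forall>f\<in>mod_hom R M V. \<forall>m\<in>carrier M. t (pure_tensor R (hom_module R M V) M f m) = f m))"

definition trace_in ::
    "('a, 'r) ring_scheme \<Rightarrow> ('a, 'c, 'n) module_scheme \<Rightarrow> ('a, 'b, 'm) module_scheme \<Rightarrow> 'c set"
  where "trace_in R V M = trace_map R M V ` carrier (tensor_module R (hom_module R M V) M)"

text \<open>HOL cannot quantify over types inside a formula. Notions that refer to all modules, or to the
  existence of some module, therefore carry a type argument \<open>'u\<close>, the universe in which the
  carriers of these modules live. The first notion does not depend on the universe as soon as it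
  contains a copy of the carrier of the ambient module (if \<open>Y\<close> is the trace of some module, it is
  the trace of \<open>Y\<close> itself), and \<open>injective_module\<close> below does not as soon as it contains a copy of
  \<open>R\<close> (Baer's criterion).\<close>

definition trace_module ::
    "'u itself \<Rightarrow> ('a, 'r) ring_scheme \<Rightarrow> ('a, 'c, 'n) module_scheme \<Rightarrow> 'c set \<Rightarrow> bool"
  where "trace_module (_ :: 'u itself) R V Y \<longleftrightarrow>
    submodule Y R V \<and> (\<exists>M :: ('a, 'u) module. module R M \<and> Y = trace_in R V M)"

definition cyclic_submodule ::
    "('a, 'r) ring_scheme \<Rightarrow> ('a, 'c, 'n) module_scheme \<Rightarrow> 'c set \<Rightarrow> bool"
  where "cyclic_submodule R V Y \<longleftrightarrow> (\<exists>x\<in>carrier V. Y = {a \<odot>\<^bsub>V\<^esub> x |a. a \<in> carrier R})"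


section \<open>Injective envelopes\<close>

definition injective_module ::
    "'u itself \<Rightarrow> ('a, 'r) ring_scheme \<Rightarrow> ('a, 'c, 'n) module_scheme \<Rightarrow> bool"
  where "injective_module (_ :: 'u itself) R E \<longleftrightarrow> module R E \<and>
    (\<forall>(A :: ('a, 'u) module) (B :: ('a, 'u) module).
      module R A \<longrightarrow> module R B \<longrightarrow>
      (\<forall>i\<in>mod_hom R A B. inj_on i (carrier A) \<longrightarrow>
        (\<forall>f\<in>mod_hom R A E. \<exists>g\<in>mod_hom R B E. \<forall>x\<in>carrier A. g (i x) = f x)))"

definition essential_mono ::
    "('a, 'r) ring_scheme \<Rightarrow> ('a, 'b, 'm) module_scheme \<Rightarrow> ('a, 'c, 'n) module_scheme
      \<Rightarrow> ('b \<Rightarrow> 'c) \<Rightarrow> bool"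
  where "essential_mono R N E j \<longleftrightarrow> j \<in> mod_hom R N E \<and> inj_on j (carrier N) \<and>
    (\<forall>H. submodule H R E \<and> H \<noteq> {\<zero>\<^bsub>E\<^esub>} \<longrightarrow> H \<inter> j ` carrier N \<noteq> {\<zero>\<^bsub>E\<^esub>})"

definition injective_envelope ::
    "'u itself \<Rightarrow> ('a, 'r) ring_scheme \<Rightarrow> ('a, 'b, 'm) module_scheme \<Rightarrow> ('a, 'c, 'n) module_scheme \<Rightarrow> bool"
  where "injective_envelope U R N E \<longleftrightarrow> injective_module U R E \<and> (\<exists>j. essential_mono R N E j)"

definition Max_spec :: "('a, 'r) ring_scheme \<Rightarrow> 'a set set"
  where "Max_spec R = {m. maximalideal m R}"


section \<open>Existence and uniqueness of the trace map\<close>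

lemma mod_homD:
  assumes "f \<in> mod_hom R M N"
  shows "x \<in> carrier M \<Longrightarrow> f x \<in> carrier N"
    and "x \<in> carrier M \<Longrightarrow> y \<in> carrier M \<Longrightarrow> f (x \<oplus>\<^bsub>M\<^esub> y) = f x \<oplus>\<^bsub>N\<^esub> f y"
    and "a \<in> carrier R \<Longrightarrow> x \<in> carrier M \<Longrightarrow> f (a \<odot>\<^bsub>M\<^esub> x) = a \<odot>\<^bsub>N\<^esub> f x"
    and "f \<in> extensional (carrier M)"
  using assms by (auto simp: mod_hom_def PiE_def)

lemma mod_hom_zero:
  assumes "module R M" "module R N" "f \<in> mod_hom R M N"
  shows "f \<zero>\<^bsub>M\<^esub> = \<zero>\<^bsub>N\<^esub>"
proof -
  interpret M: module R M by fact
  interpret N: module R N by fact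
  have "f (\<zero>\<^bsub>R\<^esub> \<odot>\<^bsub>M\<^esub> \<zero>\<^bsub>M\<^esub>) = \<zero>\<^bsub>R\<^esub> \<odot>\<^bsub>N\<^esub> f \<zero>\<^bsub>M\<^esub>"
    using mod_homD(3)[OF assms(3)] by blast
  then show ?thesis using mod_homD(1)[OF assms(3)] by simp
qed

lemma mod_hom_minus:
  assumes "module R M" "module R N" "f \<in> mod_hom R M N" "x \<in> carrier M" "y \<in> carrier M"
  shows "f (x \<ominus>\<^bsub>M\<^esub> y) = f x \<ominus>\<^bsub>N\<^esub> f y"
proof -
  interpret M: module R M by fact
  interpret N: module R N by fact
  note h = mod_homD[OF assms(3)]
  have "f ((\<ominus>\<^bsub>R\<^esub> \<one>\<^bsub>R\<^esub>) \<odot>\<^bsub>M\<^esub> y) = (\<ominus>\<^bsub>R\<^esub> \<one>\<^bsub>R\<^esub>) \<odot>\<^bsub>N\<^esub> f y"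
    using h assms by simp
  then have "f (\<ominus>\<^bsub>M\<^esub> y) = \<ominus>\<^bsub>N\<^esub> f y"
    using h assms by (simp add: M.smult_l_minus N.smult_l_minus)
  then show ?thesis using h assms by (simp add: a_minus_def)
qed

lemma abelian_groupI2:
  fixes G (structure)
  assumes "\<And>x y. x \<in> carrier G \<Longrightarrow> y \<in> carrier G \<Longrightarrow> x \<oplus> y \<in> carrier G" "\<zero> \<in> carrier G"
    "\<And>x y z. x \<in> carrier G \<Longrightarrow> y \<in> carrier G \<Longrightarrow> z \<in> carrier G \<Longrightarrow> (x \<oplus> y) \<oplus> z = x \<oplus> (y \<oplus> z)"
    "\<And>x y. x \<in> carrier G \<Longrightarrow> y \<in> carrier G \<Longrightarrow> x \<oplus> y = y \<oplus> x"
    "\<And>x. x \<in> carrier G \<Longrightarrow> \<zero> \<oplus> x = x"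
    "\<And>x. x \<in> carrier G \<Longrightarrow> \<exists>y\<in>carrier G. y \<oplus> x = \<zero>"
  shows "abelian_group G"
  using assms by (intro abelian_groupI) auto

lemma abelian_group_minus_zero:
  assumes "abelian_group G" shows "\<ominus>\<^bsub>G\<^esub> \<zero>\<^bsub>G\<^esub> = \<zero>\<^bsub>G\<^esub>"
proof -
  interpret abelian_group G by fact
  show ?thesis by simp
qed

lemma self_module_module:
  assumes "cring R" shows "module R (self_module R)"
proof -
  interpret cring R by fact
  show ?thesis
    by (rule moduleI[OF assms], rule abelian_groupI2)
       (auto simp: self_module_def a_assoc a_lcomm a_comm l_distr r_distr m_assoc intro: l_neg bexI[of _ "\<ominus>\<^bsub>R\<^esub> _"])
qed

lemma hom_module_simps:
  "carrier (hom_module R M N) = mod_hom R M N"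
  "\<zero>\<^bsub>hom_module R M N\<^esub> = (\<lambda>x\<in>carrier M. \<zero>\<^bsub>N\<^esub>)"
  "f \<oplus>\<^bsub>hom_module R M N\<^esub> g = (\<lambda>x\<in>carrier M. f x \<oplus>\<^bsub>N\<^esub> g x)"
  "a \<odot>\<^bsub>hom_module R M N\<^esub> f = (\<lambda>x\<in>carrier M. a \<odot>\<^bsub>N\<^esub> f x)"
  by (simp_all add: hom_module_def)

lemma hom_module_module:
  assumes "module R M" "module R N"
  shows "module R (hom_module R M N)"
proof -
  interpret M: module R M by fact
  interpret N: module R N by fact
  let ?H = "hom_module R M N"
  have add: "f \<oplus>\<^bsub>?H\<^esub> g \<in> mod_hom R M N" if "f \<in> mod_hom R M N" "g \<in> mod_hom R M N" for f g
    using mod_homD[OF that(1)] mod_homD[OF that(2)]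
    by (simp add: mod_hom_def hom_module_simps N.a_ac N.smult_r_distr)
  have smult: "a \<odot>\<^bsub>?H\<^esub> f \<in> mod_hom R M N" if "f \<in> mod_hom R M N" "a \<in> carrier R" for f a
  proof -
    have "a \<odot>\<^bsub>N\<^esub> (b \<odot>\<^bsub>N\<^esub> y) = b \<odot>\<^bsub>N\<^esub> (a \<odot>\<^bsub>N\<^esub> y)" if "b \<in> carrier R" "y \<in> carrier N" for b y
      using N.smult_assoc1[OF \<open>a \<in> carrier R\<close> that] N.smult_assoc1[OF that(1) \<open>a \<in> carrier R\<close> that(2)]
        M.m_comm[OF \<open>a \<in> carrier R\<close> that(1)] by simp
    then show ?thesis
      using mod_homD[OF that(1)] that(2)
      by (simp add: mod_hom_def hom_module_simps N.smult_r_distr)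
  qed
  have zero: "\<zero>\<^bsub>?H\<^esub> \<in> mod_hom R M N"
    by (simp add: mod_hom_def hom_module_simps)
  have ext: "f = (\<lambda>x\<in>carrier M. f x)" if "f \<in> mod_hom R M N" for f
    using mod_homD(4)[OF that] by (simp add: extensional_restrict)
  show ?thesis
  proof (rule moduleI[OF M.is_cring], rule abelian_groupI2, unfold hom_module_simps(1))
    fix f assume f: "f \<in> mod_hom R M N"
    show "\<exists>y\<in>mod_hom R M N. y \<oplus>\<^bsub>?H\<^esub> f = \<zero>\<^bsub>?H\<^esub>"
    proof
      have "(\<ominus>\<^bsub>R\<^esub> \<one>\<^bsub>R\<^esub>) \<odot>\<^bsub>N\<^esub> f x \<oplus>\<^bsub>N\<^esub> f x = \<zero>\<^bsub>N\<^esub>" if "x \<in> carrier M" for x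
        using mod_homD(1)[OF f that] by (simp add: N.smult_l_minus N.l_neg)
      then show "((\<ominus>\<^bsub>R\<^esub> \<one>\<^bsub>R\<^esub>) \<odot>\<^bsub>?H\<^esub> f) \<oplus>\<^bsub>?H\<^esub> f = \<zero>\<^bsub>?H\<^esub>"
        by (simp add: hom_module_simps cong: restrict_cong)
      show "(\<ominus>\<^bsub>R\<^esub> \<one>\<^bsub>R\<^esub>) \<odot>\<^bsub>?H\<^esub> f \<in> mod_hom R M N"
        using smult[OF f] by simp
    qed
    show "\<zero>\<^bsub>?H\<^esub> \<oplus>\<^bsub>?H\<^esub> f = f" "\<one>\<^bsub>R\<^esub> \<odot>\<^bsub>?H\<^esub> f = f"
      by (subst (2) ext[OF f], simp add: hom_module_simps mod_homD(1)[OF f] cong: restrict_cong)+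
  next
    fix f g assume fg: "f \<in> mod_hom R M N" "g \<in> mod_hom R M N"
    then show "f \<oplus>\<^bsub>?H\<^esub> g = g \<oplus>\<^bsub>?H\<^esub> f"
      by (simp add: hom_module_simps mod_homD(1)[OF fg(1)] mod_homD(1)[OF fg(2)] N.a_comm cong: restrict_cong)
    fix h assume h: "h \<in> mod_hom R M N"
    show "f \<oplus>\<^bsub>?H\<^esub> g \<oplus>\<^bsub>?H\<^esub> h = f \<oplus>\<^bsub>?H\<^esub> (g \<oplus>\<^bsub>?H\<^esub> h)"
      by (simp add: hom_module_simps mod_homD(1)[OF fg(1)] mod_homD(1)[OF fg(2)] mod_homD(1)[OF h]
          N.a_assoc cong: restrict_cong)
  next
    fix a f g assume a: "a \<in> carrier R" and fg: "f \<in> mod_hom R M N" "g \<in> mod_hom R M N"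
    then show "a \<odot>\<^bsub>?H\<^esub> (f \<oplus>\<^bsub>?H\<^esub> g) = a \<odot>\<^bsub>?H\<^esub> f \<oplus>\<^bsub>?H\<^esub> a \<odot>\<^bsub>?H\<^esub> g"
      by (simp add: hom_module_simps mod_homD(1)[OF fg(1)] mod_homD(1)[OF fg(2)] N.smult_r_distr
          cong: restrict_cong)
  next
    fix a b f assume ab: "a \<in> carrier R" "b \<in> carrier R" and f: "f \<in> mod_hom R M N"
    then show "(a \<oplus>\<^bsub>R\<^esub> b) \<odot>\<^bsub>?H\<^esub> f = a \<odot>\<^bsub>?H\<^esub> f \<oplus>\<^bsub>?H\<^esub> b \<odot>\<^bsub>?H\<^esub> f"
      and "a \<otimes>\<^bsub>R\<^esub> b \<odot>\<^bsub>?H\<^esub> f = a \<odot>\<^bsub>?H\<^esub> (b \<odot>\<^bsub>?H\<^esub> f)"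
      by (simp_all add: hom_module_simps mod_homD(1)[OF f] N.smult_l_distr N.smult_assoc1
          cong: restrict_cong)
  qed (use add smult zero in auto)
qed

lemma direct_sum_simps:
  "carrier (direct_sum I M) = {x \<in> \<Pi>\<^sub>E i\<in>I. carrier (M i). finite {i \<in> I. x i \<noteq> \<zero>\<^bsub>M i\<^esub>}}"
  "\<zero>\<^bsub>direct_sum I M\<^esub> = (\<lambda>i\<in>I. \<zero>\<^bsub>M i\<^esub>)"
  "x \<oplus>\<^bsub>direct_sum I M\<^esub> y = (\<lambda>i\<in>I. x i \<oplus>\<^bsub>M i\<^esub> y i)"
  "a \<odot>\<^bsub>direct_sum I M\<^esub> x = (\<lambda>i\<in>I. a \<odot>\<^bsub>M i\<^esub> x i)"
  by (simp_all add: direct_sum_def)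

lemma direct_sum_module:
  assumes R: "cring R" and M: "\<And>i. i \<in> I \<Longrightarrow> module R (M i)"
  shows "module R (direct_sum I M)"
proof -
  let ?S = "direct_sum I M"
  have ab: "abelian_group (M i)" if "i \<in> I" for i using M[OF that] by (simp add: module_def)
  note mon = abelian_group.axioms(1)[OF ab]
  have PE: "f \<in> Pi\<^sub>E I (\<lambda>i. carrier (M i)) \<Longrightarrow> i \<in> I \<Longrightarrow> f i \<in> carrier (M i)" for f i by auto
  have addc: "x \<oplus>\<^bsub>?S\<^esub> y \<in> carrier ?S" if "x \<in> carrier ?S" "y \<in> carrier ?S" for x y
  proof -
    have "{i \<in> I. x i \<oplus>\<^bsub>M i\<^esub> y i \<noteq> \<zero>\<^bsub>M i\<^esub>} \<subseteq> {i \<in> I. x i \<noteq> \<zero>\<^bsub>M i\<^esub>} \<union> {i \<in> I. y i \<noteq> \<zero>\<^bsub>M i\<^esub>}"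
      using abelian_monoid.l_zero[OF mon] abelian_monoid.zero_closed[OF mon] by auto
    then have "finite {i \<in> I. x i \<oplus>\<^bsub>M i\<^esub> y i \<noteq> \<zero>\<^bsub>M i\<^esub>}"
      using that finite_subset by (auto simp: direct_sum_simps)
    then show ?thesis
      using that by (auto simp: direct_sum_simps PE abelian_monoid.a_closed[OF mon] cong: conj_cong)
  qed
  have smc: "a \<odot>\<^bsub>?S\<^esub> x \<in> carrier ?S" if "x \<in> carrier ?S" "a \<in> carrier R" for x a
  proof -
    have "{i \<in> I. a \<odot>\<^bsub>M i\<^esub> x i \<noteq> \<zero>\<^bsub>M i\<^esub>} \<subseteq> {i \<in> I. x i \<noteq> \<zero>\<^bsub>M i\<^esub>}"
      using module.smult_r_null[OF M] that by auto
    then have "finite {i \<in> I. a \<odot>\<^bsub>M i\<^esub> x i \<noteq> \<zero>\<^bsub>M i\<^esub>}"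
      using that finite_subset by (auto simp: direct_sum_simps)
    then show ?thesis
      using that by (auto simp: direct_sum_simps PE module.smult_closed[OF M] cong: conj_cong)
  qed
  show ?thesis
  proof (rule moduleI[OF R], rule abelian_groupI2)
    fix x assume x: "x \<in> carrier ?S"
    let ?y = "\<lambda>i\<in>I. \<ominus>\<^bsub>M i\<^esub> x i"
    have "{i \<in> I. \<ominus>\<^bsub>M i\<^esub> x i \<noteq> \<zero>\<^bsub>M i\<^esub>} \<subseteq> {i \<in> I. x i \<noteq> \<zero>\<^bsub>M i\<^esub>}"
      using abelian_group_minus_zero[OF ab] by auto
    then have "finite {i \<in> I. \<ominus>\<^bsub>M i\<^esub> x i \<noteq> \<zero>\<^bsub>M i\<^esub>}"
      using x finite_subset by (auto simp: direct_sum_simps)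
    then have "?y \<in> carrier ?S"
      using x by (auto simp: direct_sum_simps PE abelian_group.a_inv_closed[OF ab] cong: conj_cong)
    moreover have "?y \<oplus>\<^bsub>?S\<^esub> x = \<zero>\<^bsub>?S\<^esub>"
      using x by (auto simp: direct_sum_simps PE abelian_group.l_neg[OF ab] intro!: restrict_ext)
    ultimately show "\<exists>y\<in>carrier ?S. y \<oplus>\<^bsub>?S\<^esub> x = \<zero>\<^bsub>?S\<^esub>" by blast
  next
    fix a b x assume "a \<in> carrier R" "b \<in> carrier R" "x \<in> carrier ?S"
    then show "(a \<oplus>\<^bsub>R\<^esub> b) \<odot>\<^bsub>?S\<^esub> x = a \<odot>\<^bsub>?S\<^esub> x \<oplus>\<^bsub>?S\<^esub> b \<odot>\<^bsub>?S\<^esub> x"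
       and "(a \<otimes>\<^bsub>R\<^esub> b) \<odot>\<^bsub>?S\<^esub> x = a \<odot>\<^bsub>?S\<^esub> (b \<odot>\<^bsub>?S\<^esub> x)"
      by (auto simp: direct_sum_simps PE module.smult_l_distr[OF M] module.smult_assoc1[OF M]
          intro!: restrict_ext)
  next
    fix a x y assume "a \<in> carrier R" "x \<in> carrier ?S" "y \<in> carrier ?S"
    then show "a \<odot>\<^bsub>?S\<^esub> (x \<oplus>\<^bsub>?S\<^esub> y) = a \<odot>\<^bsub>?S\<^esub> x \<oplus>\<^bsub>?S\<^esub> a \<odot>\<^bsub>?S\<^esub> y"
      by (auto simp: direct_sum_simps PE module.smult_r_distr[OF M] intro!: restrict_ext)
  next
    fix x y z assume "x \<in> carrier ?S" "y \<in> carrier ?S" "z \<in> carrier ?S"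
    then show "x \<oplus>\<^bsub>?S\<^esub> y \<oplus>\<^bsub>?S\<^esub> z = x \<oplus>\<^bsub>?S\<^esub> (y \<oplus>\<^bsub>?S\<^esub> z)"
      by (auto simp: direct_sum_simps PE abelian_monoid.a_assoc[OF mon] intro!: restrict_ext)
  next
    fix x y assume "x \<in> carrier ?S" "y \<in> carrier ?S"
    then show "x \<oplus>\<^bsub>?S\<^esub> y = y \<oplus>\<^bsub>?S\<^esub> x"
      by (auto simp: direct_sum_simps PE abelian_monoid.a_comm[OF mon] intro!: restrict_ext)
  next
    show "\<zero>\<^bsub>?S\<^esub> \<in> carrier ?S"
      by (auto simp: direct_sum_simps abelian_monoid.zero_closed[OF mon] cong: conj_cong)
  next
    fix x assume "x \<in> carrier ?S"
    then show "\<zero>\<^bsub>?S\<^esub> \<oplus>\<^bsub>?S\<^esub> x = x" "\<one>\<^bsub>R\<^esub> \<odot>\<^bsub>?S\<^esub> x = x"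
      by (auto simp: direct_sum_simps PE abelian_monoid.l_zero[OF mon] module.smult_one[OF M]
          PiE_iff intro!: extensionalityI[of _ I])
  qed (use addc smc in auto)
qed

lemma quot_module_simps:
  "carrier (quot_module M H) = a_rcosets\<^bsub>M\<^esub> H"
  "\<zero>\<^bsub>quot_module M H\<^esub> = H"
  "C \<oplus>\<^bsub>quot_module M H\<^esub> D = C <+>\<^bsub>M\<^esub> D"
  "a \<odot>\<^bsub>quot_module M H\<^esub> C = (\<Union>x\<in>C. H +>\<^bsub>M\<^esub> (a \<odot>\<^bsub>M\<^esub> x))"
  by (simp_all add: quot_module_def)

lemma submodule_abelian_subgroup:
  assumes "module R M" "submodule H R M"
  shows "abelian_subgroup H M"
  using assms by (intro abelian_subgroupI3)
    (simp_all add: additive_subgroup_def submodule_def module_def)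

lemma quot_module_smult:
  assumes "module R M" "submodule H R M" "a \<in> carrier R" "x \<in> carrier M"
  shows "a \<odot>\<^bsub>quot_module M H\<^esub> (H +>\<^bsub>M\<^esub> x) = H +>\<^bsub>M\<^esub> (a \<odot>\<^bsub>M\<^esub> x)"
proof -
  interpret M: module R M by fact
  interpret H: abelian_subgroup H M using assms by (intro submodule_abelian_subgroup)
  note sub = M.submoduleE[OF assms(2)]
  have "H +>\<^bsub>M\<^esub> (a \<odot>\<^bsub>M\<^esub> z) = H +>\<^bsub>M\<^esub> (a \<odot>\<^bsub>M\<^esub> x)" if "z \<in> H +>\<^bsub>M\<^esub> x" for z
  proof -
    obtain h where h: "h \<in> H" "z = h \<oplus>\<^bsub>M\<^esub> x" using \<open>z \<in> _\<close> by (auto simp: a_r_coset_def')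
    then have "a \<odot>\<^bsub>M\<^esub> z = a \<odot>\<^bsub>M\<^esub> h \<oplus>\<^bsub>M\<^esub> a \<odot>\<^bsub>M\<^esub> x"
      using assms sub by (auto simp: M.smult_r_distr)
    then have "a \<odot>\<^bsub>M\<^esub> z \<in> H +>\<^bsub>M\<^esub> (a \<odot>\<^bsub>M\<^esub> x)"
      using sub(4)[OF assms(3) h(1)] by (auto simp: a_r_coset_def')
    then show ?thesis
      using H.a_repr_independence' assms by (metis M.smult_closed)
  qed
  moreover have "x \<in> H +>\<^bsub>M\<^esub> x" by (rule H.a_rcos_self[OF assms(4)])
  ultimately show ?thesis unfolding quot_module_simps by blast
qed

lemma quot_module_module:
  assumes "module R M" "submodule H R M"
  shows "module R (quot_module M H)"
proof -
  interpret M: module R M by fact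
  interpret H: abelian_subgroup H M using assms by (intro submodule_abelian_subgroup)
  let ?Q = "quot_module M H"
  have rep: "\<exists>x\<in>carrier M. C = H +>\<^bsub>M\<^esub> x" if "C \<in> carrier ?Q" for C
    using that by (auto simp: quot_module_simps A_RCOSETS_def')
  have mem: "H +>\<^bsub>M\<^esub> x \<in> carrier ?Q" if "x \<in> carrier M" for x
    using that by (auto simp: quot_module_simps A_RCOSETS_def')
  have zero: "\<zero>\<^bsub>?Q\<^esub> = H +>\<^bsub>M\<^esub> \<zero>\<^bsub>M\<^esub>"
    using H.a_subset by (simp add: quot_module_simps)
  have add: "(H +>\<^bsub>M\<^esub> x) \<oplus>\<^bsub>?Q\<^esub> (H +>\<^bsub>M\<^esub> y) = H +>\<^bsub>M\<^esub> (x \<oplus>\<^bsub>M\<^esub> y)"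
    if "x \<in> carrier M" "y \<in> carrier M" for x y
    using H.a_rcos_sum that by (simp add: quot_module_simps)
  note sm = quot_module_smult[OF assms]
  show ?thesis
  proof (rule moduleI[OF M.is_cring], rule abelian_groupI2)
    fix C assume "C \<in> carrier ?Q"
    then obtain x where x: "x \<in> carrier M" "C = H +>\<^bsub>M\<^esub> x" using rep by blast
    show "\<zero>\<^bsub>?Q\<^esub> \<oplus>\<^bsub>?Q\<^esub> C = C" "\<one>\<^bsub>R\<^esub> \<odot>\<^bsub>?Q\<^esub> C = C"
      using x by (simp_all add: zero add sm)
    show "\<exists>y\<in>carrier ?Q. y \<oplus>\<^bsub>?Q\<^esub> C = \<zero>\<^bsub>?Q\<^esub>"
      using x by (intro bexI[of _ "H +>\<^bsub>M\<^esub> (\<ominus>\<^bsub>M\<^esub> x)"]) (simp_all add: zero add mem M.l_neg)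
  next
    fix C D assume "C \<in> carrier ?Q" "D \<in> carrier ?Q"
    then obtain x y where xy: "x \<in> carrier M" "C = H +>\<^bsub>M\<^esub> x" "y \<in> carrier M" "D = H +>\<^bsub>M\<^esub> y"
      using rep by meson
    then show "C \<oplus>\<^bsub>?Q\<^esub> D = D \<oplus>\<^bsub>?Q\<^esub> C" "C \<oplus>\<^bsub>?Q\<^esub> D \<in> carrier ?Q"
      by (simp_all add: add mem M.a_comm)
    fix B assume "B \<in> carrier ?Q"
    then obtain z where "z \<in> carrier M" "B = H +>\<^bsub>M\<^esub> z" using rep by blast
    then show "C \<oplus>\<^bsub>?Q\<^esub> D \<oplus>\<^bsub>?Q\<^esub> B = C \<oplus>\<^bsub>?Q\<^esub> (D \<oplus>\<^bsub>?Q\<^esub> B)"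
      using xy by (simp add: add M.a_assoc)
  next
    show "\<zero>\<^bsub>?Q\<^esub> \<in> carrier ?Q" using mem zero by simp
  next
    fix a C assume a: "a \<in> carrier R" and "C \<in> carrier ?Q"
    then obtain x where x: "x \<in> carrier M" "C = H +>\<^bsub>M\<^esub> x" using rep by blast
    show "a \<odot>\<^bsub>?Q\<^esub> C \<in> carrier ?Q" using a x by (simp add: sm mem)
    fix b assume b: "b \<in> carrier R"
    show "(a \<oplus>\<^bsub>R\<^esub> b) \<odot>\<^bsub>?Q\<^esub> C = a \<odot>\<^bsub>?Q\<^esub> C \<oplus>\<^bsub>?Q\<^esub> b \<odot>\<^bsub>?Q\<^esub> C"
      and "a \<otimes>\<^bsub>R\<^esub> b \<odot>\<^bsub>?Q\<^esub> C = a \<odot>\<^bsub>?Q\<^esub> (b \<odot>\<^bsub>?Q\<^esub> C)"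
      using a b x by (simp_all add: sm add M.smult_l_distr M.smult_assoc1)
  next
    fix a C D assume a: "a \<in> carrier R" and "C \<in> carrier ?Q" "D \<in> carrier ?Q"
    then obtain x y where "x \<in> carrier M" "C = H +>\<^bsub>M\<^esub> x" "y \<in> carrier M" "D = H +>\<^bsub>M\<^esub> y"
      using rep by meson
    then show "a \<odot>\<^bsub>?Q\<^esub> (C \<oplus>\<^bsub>?Q\<^esub> D) = a \<odot>\<^bsub>?Q\<^esub> C \<oplus>\<^bsub>?Q\<^esub> a \<odot>\<^bsub>?Q\<^esub> D"
      using a by (simp add: sm add M.smult_r_distr)
  qed
qed

text \<open>Factorization of a linear map through the quotient.\<close>

lemma quot_module_lift:
  assumes M: "module R M" and N: "module R N" and H: "submodule H R M"
    and f: "f \<in> mod_hom R M N" and ker: "\<And>x. x \<in> H \<Longrightarrow> f x = \<zero>\<^bsub>N\<^esub>"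
  shows "\<exists>t\<in>mod_hom R (quot_module M H) N. \<forall>x\<in>carrier M. t (H +>\<^bsub>M\<^esub> x) = f x"
proof -
  interpret M: module R M by fact
  interpret N: module R N by fact
  interpret H: abelian_subgroup H M using M H by (intro submodule_abelian_subgroup)
  let ?Q = "quot_module M H"
  define t where "t = (\<lambda>C\<in>carrier ?Q. f (SOME x. x \<in> C))"
  note h = mod_homD[OF f]
  have rep: "\<exists>x\<in>carrier M. C = H +>\<^bsub>M\<^esub> x" if "C \<in> carrier ?Q" for C
    using that by (auto simp: quot_module_simps A_RCOSETS_def')
  have mem: "H +>\<^bsub>M\<^esub> x \<in> carrier ?Q" if "x \<in> carrier M" for x
    using that by (auto simp: quot_module_simps A_RCOSETS_def')
  have const: "f z = f x" if "z \<in> H +>\<^bsub>M\<^esub> x" "x \<in> carrier M" for x z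
    using that h ker H.a_subset by (auto simp: a_r_coset_def' subset_iff)
  have t: "t (H +>\<^bsub>M\<^esub> x) = f x" if "x \<in> carrier M" for x
    unfolding t_def using mem[OF that] const[OF _ that] H.a_rcos_self[OF that]
    by (metis (mono_tags, lifting) restrict_apply' someI)
  have add: "(H +>\<^bsub>M\<^esub> x) \<oplus>\<^bsub>?Q\<^esub> (H +>\<^bsub>M\<^esub> y) = H +>\<^bsub>M\<^esub> (x \<oplus>\<^bsub>M\<^esub> y)"
    if "x \<in> carrier M" "y \<in> carrier M" for x y
    using H.a_rcos_sum that by (simp add: quot_module_simps)
  note sm = quot_module_smult[OF M H]
  have "t \<in> mod_hom R ?Q N"
    unfolding mod_hom_def
  proof (intro CollectI conjI ballI)
    have "t C \<in> carrier N" if "C \<in> carrier ?Q" for C using rep[OF that] t h by auto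
    then show "t \<in> carrier ?Q \<rightarrow>\<^sub>E carrier N" by (auto simp: t_def)
  next
    fix C D assume "C \<in> carrier ?Q" "D \<in> carrier ?Q"
    then obtain x y where "x \<in> carrier M" "C = H +>\<^bsub>M\<^esub> x" "y \<in> carrier M" "D = H +>\<^bsub>M\<^esub> y"
      using rep by meson
    then show "t (C \<oplus>\<^bsub>?Q\<^esub> D) = t C \<oplus>\<^bsub>N\<^esub> t D" by (simp add: add t h)
  next
    fix a C assume "a \<in> carrier R" "C \<in> carrier ?Q"
    moreover then obtain x where "x \<in> carrier M" "C = H +>\<^bsub>M\<^esub> x" using rep by blast
    ultimately show "t (a \<odot>\<^bsub>?Q\<^esub> C) = a \<odot>\<^bsub>N\<^esub> t C" by (simp add: sm t h)
  qed
  then show ?thesis using t by blast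
qed

lemma hull_submodule:
  assumes "module R M" "S \<subseteq> carrier M"
  shows "submodule ((\<lambda>H. submodule H R M) hull S) R M"
proof -
  interpret M: module R M by fact
  let ?K = "(\<lambda>H. submodule H R M) hull S"
  have K: "x \<in> ?K \<longleftrightarrow> (\<forall>H. submodule H R M \<and> S \<subseteq> H \<longrightarrow> x \<in> H)" for x
    by (auto simp: hull_def)
  have c: "submodule (carrier M) R M" by (rule M.carrier_is_submodule)
  show ?thesis
  proof (rule M.submoduleI)
    show "?K \<subseteq> carrier M" using c assms(2) by (auto simp: K)
    show "\<zero>\<^bsub>M\<^esub> \<in> ?K"
    proof -
      have "\<zero>\<^bsub>M\<^esub> \<in> H" if "submodule H R M" for H
        using subgroup.one_closed[of H "add_monoid M"] submodule.axioms(1)[OF that] by simp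
      then show ?thesis by (simp add: K)
    qed
  qed (use M.submoduleE in \<open>auto simp: K\<close>)
qed

lemma preimage_submodule:
  assumes M: "module R M" and N: "module R N" and f: "f \<in> mod_hom R M N" and H: "submodule H R N"
  shows "submodule {x \<in> carrier M. f x \<in> H} R M"
proof -
  interpret M: module R M by fact
  interpret N: module R N by fact
  note h = mod_homD[OF f] and sub = N.submoduleE[OF H]
  have z: "\<zero>\<^bsub>N\<^esub> \<in> H"
    using subgroup.one_closed[of H "add_monoid N"] submodule.axioms(1)[OF H] by simp
  have "f (\<ominus>\<^bsub>M\<^esub> x) = \<ominus>\<^bsub>N\<^esub> f x" if "x \<in> carrier M" for x
    using mod_hom_minus[OF M N f M.zero_closed that] mod_hom_zero[OF M N f] that h
    by (simp add: a_minus_def)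
  then show ?thesis
    using mod_hom_zero[OF M N f] z h sub by (intro M.submoduleI) auto
qed

lemma image_submodule:
  assumes M: "module R M" and N: "module R N" and f: "f \<in> mod_hom R M N"
  shows "submodule (f ` carrier M) R N"
proof -
  interpret M: module R M by fact
  interpret N: module R N by fact
  note h = mod_homD[OF f]
  have m: "\<ominus>\<^bsub>N\<^esub> f x = f (\<ominus>\<^bsub>M\<^esub> x)" if "x \<in> carrier M" for x
    using mod_hom_minus[OF M N f M.zero_closed that] mod_hom_zero[OF M N f] that h
    by (simp add: a_minus_def)
  show ?thesis
  proof (rule N.submoduleI)
    show "\<zero>\<^bsub>N\<^esub> \<in> f ` carrier M"
      using mod_hom_zero[OF M N f] M.zero_closed by (metis imageI)
  qed (auto simp: m h(1) h(2,3)[symmetric])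
qed

lemma equalizer_submodule:
  assumes M: "module R M" and N: "module R N" and f: "f \<in> mod_hom R M N" and g: "g \<in> mod_hom R M N"
  shows "submodule {x \<in> carrier M. f x = g x} R M"
proof -
  interpret M: module R M by fact
  interpret N: module R N by fact
  note h = mod_homD[OF f] mod_homD[OF g]
  have "f (\<ominus>\<^bsub>M\<^esub> x) = \<ominus>\<^bsub>N\<^esub> f x" "g (\<ominus>\<^bsub>M\<^esub> x) = \<ominus>\<^bsub>N\<^esub> g x" if "x \<in> carrier M" for x
    using mod_hom_minus[OF M N f M.zero_closed that] mod_hom_zero[OF M N f]
      mod_hom_minus[OF M N g M.zero_closed that] mod_hom_zero[OF M N g] that h
    by (simp_all add: a_minus_def)
  then show ?thesis
    using mod_hom_zero[OF M N f] mod_hom_zero[OF M N g] h by (intro M.submoduleI) auto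
qed

lemma free_module_simps:
  "carrier (free_module R S) = {c \<in> S \<rightarrow>\<^sub>E carrier R. finite {p \<in> S. c p \<noteq> \<zero>\<^bsub>R\<^esub>}}"
  "\<zero>\<^bsub>free_module R S\<^esub> = (\<lambda>p\<in>S. \<zero>\<^bsub>R\<^esub>)"
  "c \<oplus>\<^bsub>free_module R S\<^esub> d = (\<lambda>p\<in>S. c p \<oplus>\<^bsub>R\<^esub> d p)"
  "a \<odot>\<^bsub>free_module R S\<^esub> c = (\<lambda>p\<in>S. a \<otimes>\<^bsub>R\<^esub> c p)"
  by (simp_all add: direct_sum_simps self_module_def)

lemma free_module_module: "cring R \<Longrightarrow> module R (free_module R S)"
  by (intro direct_sum_module self_module_module)

lemma free_basis_carrier:
  assumes "cring R" "p \<in> S" shows "free_basis R S p \<in> carrier (free_module R S)"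
proof -
  interpret cring R by fact
  have "finite {q \<in> S. free_basis R S p q \<noteq> \<zero>\<^bsub>R\<^esub>}"
    by (rule finite_subset[of _ "{p}"]) (auto simp: free_basis_def)
  then show ?thesis by (auto simp: free_module_simps free_basis_def)
qed

lemma free_module_generated:
  assumes R: "cring R" and H: "submodule H R (free_module R S)"
    and b: "\<And>p. p \<in> S \<Longrightarrow> free_basis R S p \<in> H" and c: "c \<in> carrier (free_module R S)"
  shows "c \<in> H"
proof -
  interpret cring R by fact
  let ?F = "free_module R S"
  interpret F: module R ?F by (rule free_module_module[OF R])
  note sub = F.submoduleE[OF H]
  have z: "\<zero>\<^bsub>?F\<^esub> \<in> H"
    using subgroup.one_closed[of H "add_monoid ?F"] submodule.axioms(1)[OF H] by simp
  have "c \<in> H" if "c \<in> S \<rightarrow>\<^sub>E carrier R" "finite A" "{p \<in> S. c p \<noteq> \<zero>\<^bsub>R\<^esub>} = A" for c A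
    using that(2,1,3)
  proof (induction A arbitrary: c rule: finite_induct)
    case empty
    then have "c = \<zero>\<^bsub>?F\<^esub>" unfolding free_module_simps
      by (intro extensionalityI[of _ S]) (auto simp: PiE_def)
    then show ?case using z by simp
  next
    case (insert p A)
    then have p: "p \<in> S" by auto
    define d where "d = (\<lambda>q\<in>S. if q = p then \<zero>\<^bsub>R\<^esub> else c q)"
    have "d \<in> S \<rightarrow>\<^sub>E carrier R" using insert.prems by (auto simp: d_def)
    moreover have "{q \<in> S. d q \<noteq> \<zero>\<^bsub>R\<^esub>} = A" using insert.prems insert.hyps by (auto simp: d_def)
    ultimately have "d \<in> H" using insert.IH by blast
    moreover have "c p \<odot>\<^bsub>?F\<^esub> free_basis R S p \<in> H"
      using insert.prems p by (intro sub(4) b) auto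
    moreover have "c = d \<oplus>\<^bsub>?F\<^esub> (c p \<odot>\<^bsub>?F\<^esub> free_basis R S p)"
    proof (rule extensionalityI[of _ S])
      fix q assume "q \<in> S"
      moreover have "c q \<in> carrier R" "c p \<in> carrier R" using insert.prems p \<open>q \<in> S\<close> by auto
      ultimately show "c q = (d \<oplus>\<^bsub>?F\<^esub> (c p \<odot>\<^bsub>?F\<^esub> free_basis R S p)) q"
        by (simp add: free_module_simps d_def free_basis_def)
    qed (use insert.prems in \<open>auto simp: PiE_def free_module_simps\<close>)
    ultimately show ?case using sub(5) by metis
  qed
  then show ?thesis using c by (auto simp: free_module_simps)
qed

lemma free_module_lift:
  assumes N: "module R N" and g: "g \<in> S \<rightarrow> carrier N"
  shows "\<exists>\<phi>\<in>mod_hom R (free_module R S) N. \<forall>p\<in>S. \<phi> (free_basis R S p) = g p"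
proof -
  interpret N: module R N by fact
  let ?F = "free_module R S"
  have R: "cring R" by (rule N.is_cring)
  interpret F: module R ?F by (rule free_module_module[OF R])
  define \<phi> where "\<phi> = (\<lambda>c\<in>carrier ?F. \<Oplus>\<^bsub>N\<^esub>p\<in>{p \<in> S. c p \<noteq> \<zero>\<^bsub>R\<^esub>}. c p \<odot>\<^bsub>N\<^esub> g p)"
  have gc: "p \<in> S \<Longrightarrow> g p \<in> carrier N" for p using g by auto
  have cc: "c \<in> carrier ?F \<Longrightarrow> p \<in> S \<Longrightarrow> c p \<in> carrier R" for c p by (auto simp: free_module_simps)
  have fin: "c \<in> carrier ?F \<Longrightarrow> finite {p \<in> S. c p \<noteq> \<zero>\<^bsub>R\<^esub>}" for c by (auto simp: free_module_simps)
  have phi: "\<phi> c = (\<Oplus>\<^bsub>N\<^esub>p\<in>A. c p \<odot>\<^bsub>N\<^esub> g p)"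
    if "c \<in> carrier ?F" "finite A" "A \<subseteq> S" "{p \<in> S. c p \<noteq> \<zero>\<^bsub>R\<^esub>} \<subseteq> A" for c A
    unfolding \<phi>_def using that gc cc
    by (auto intro!: N.add.finprod_mono_neutral_cong_left)
  have "\<phi> \<in> mod_hom R ?F N"
    unfolding mod_hom_def
  proof (intro CollectI conjI ballI)
    show "\<phi> \<in> carrier ?F \<rightarrow>\<^sub>E carrier N"
      using gc cc by (auto simp: \<phi>_def intro!: N.finsum_closed)
  next
    fix c d assume cd: "c \<in> carrier ?F" "d \<in> carrier ?F"
    let ?A = "{p \<in> S. c p \<noteq> \<zero>\<^bsub>R\<^esub>} \<union> {p \<in> S. d p \<noteq> \<zero>\<^bsub>R\<^esub>}"
    have A: "finite ?A" "?A \<subseteq> S" using fin cd by auto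
    have "\<phi> (c \<oplus>\<^bsub>?F\<^esub> d) = (\<Oplus>\<^bsub>N\<^esub>p\<in>?A. (c \<oplus>\<^bsub>?F\<^esub> d) p \<odot>\<^bsub>N\<^esub> g p)"
      using cd A by (intro phi F.a_closed) (auto simp: free_module_simps(3))
    also have "\<dots> = (\<Oplus>\<^bsub>N\<^esub>p\<in>?A. c p \<odot>\<^bsub>N\<^esub> g p \<oplus>\<^bsub>N\<^esub> d p \<odot>\<^bsub>N\<^esub> g p)"
      using A gc cc cd by (intro N.finsum_cong') (auto simp: free_module_simps(3) N.smult_l_distr)
    also have "\<dots> = (\<Oplus>\<^bsub>N\<^esub>p\<in>?A. c p \<odot>\<^bsub>N\<^esub> g p) \<oplus>\<^bsub>N\<^esub> (\<Oplus>\<^bsub>N\<^esub>p\<in>?A. d p \<odot>\<^bsub>N\<^esub> g p)"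
      using A gc cc cd by (intro N.finsum_addf) auto
    also have "\<dots> = \<phi> c \<oplus>\<^bsub>N\<^esub> \<phi> d"
      using cd A by (subst (1 2) phi[of _ ?A]) auto
    finally show "\<phi> (c \<oplus>\<^bsub>?F\<^esub> d) = \<phi> c \<oplus>\<^bsub>N\<^esub> \<phi> d" .
  next
    fix a c assume ac: "a \<in> carrier R" "c \<in> carrier ?F"
    let ?A = "{p \<in> S. c p \<noteq> \<zero>\<^bsub>R\<^esub>}"
    have A: "finite ?A" "?A \<subseteq> S" using fin ac by auto
    have "\<phi> (a \<odot>\<^bsub>?F\<^esub> c) = (\<Oplus>\<^bsub>N\<^esub>p\<in>?A. (a \<odot>\<^bsub>?F\<^esub> c) p \<odot>\<^bsub>N\<^esub> g p)"
      using ac A by (intro phi F.smult_closed) (auto simp: free_module_simps(4))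
    also have "\<dots> = (\<Oplus>\<^bsub>N\<^esub>p\<in>?A. a \<odot>\<^bsub>N\<^esub> (c p \<odot>\<^bsub>N\<^esub> g p))"
      using A gc cc ac by (intro N.finsum_cong') (auto simp: free_module_simps(4) N.smult_assoc1)
    also have "\<dots> = a \<odot>\<^bsub>N\<^esub> (\<Oplus>\<^bsub>N\<^esub>p\<in>?A. c p \<odot>\<^bsub>N\<^esub> g p)"
      using A gc cc ac by (intro N.finsum_smult_ldistr[symmetric]) auto
    also have "\<dots> = a \<odot>\<^bsub>N\<^esub> \<phi> c"
      using ac A by (subst phi[of _ ?A]) auto
    finally show "\<phi> (a \<odot>\<^bsub>?F\<^esub> c) = a \<odot>\<^bsub>N\<^esub> \<phi> c" .
  qed
  moreover have "\<phi> (free_basis R S p) = g p" if "p \<in> S" for p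
  proof -
    have "\<phi> (free_basis R S p) = (\<Oplus>\<^bsub>N\<^esub>q\<in>{p}. free_basis R S p q \<odot>\<^bsub>N\<^esub> g q)"
      using that by (intro phi free_basis_carrier R) (auto simp: free_basis_def)
    also have "\<dots> = (\<Oplus>\<^bsub>N\<^esub>q\<in>{p}. g q)"
      using that gc by (intro N.finsum_cong') (auto simp: free_basis_def)
    also have "\<dots> = g p" using that gc by simp
    finally show ?thesis .
  qed
  ultimately show ?thesis by blast
qed

lemma tensor_free_module: "cring R \<Longrightarrow> module R (tensor_free R M N)"
  unfolding tensor_free_def by (rule free_module_module)

lemma tensor_rels_carrier:
  assumes M: "module R M" and N: "module R N"
  shows "tensor_rels R M N \<subseteq> carrier (tensor_free R M N)"
proof -
  interpret M: module R M by fact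
  interpret N: module R N by fact
  interpret F: module R "tensor_free R M N" by (rule tensor_free_module[OF M.is_cring])
  have b: "free_basis R (carrier M \<times> carrier N) (x, y) \<in> carrier (tensor_free R M N)"
    if "x \<in> carrier M" "y \<in> carrier N" for x y
    using that by (simp add: tensor_free_def free_basis_carrier[OF M.is_cring])
  show ?thesis by (auto simp: tensor_rels_def Let_def b)
qed

lemma tensor_ker_submodule:
  assumes "module R M" "module R N"
  shows "submodule (tensor_ker R M N) R (tensor_free R M N)"
  unfolding tensor_ker_def using assms
  by (intro hull_submodule tensor_free_module tensor_rels_carrier) (auto simp: module_def)

lemma tensor_module_module:
  assumes "module R M" "module R N"
  shows "module R (tensor_module R M N)"
  unfolding tensor_module_def using assms
  by (intro quot_module_module tensor_free_module tensor_ker_submodule) (auto simp: module_def)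

lemma trace_map_exists:
  assumes M: "module R M" and V: "module R V"
  shows "\<exists>t\<in>mod_hom R (tensor_module R (hom_module R M V) M) V.
    \<forall>f\<in>mod_hom R M V. \<forall>m\<in>carrier M. t (pure_tensor R (hom_module R M V) M f m) = f m"
proof -
  let ?H = "hom_module R M V" let ?F = "tensor_free R ?H M" let ?S = "carrier ?H \<times> carrier M"
  interpret M: module R M by fact
  interpret V: module R V by fact
  have R: "cring R" by (rule M.is_cring)
  have H: "module R ?H" by (rule hom_module_module[OF M V])
  interpret H: module R ?H by fact
  have F: "module R ?F" by (rule tensor_free_module[OF R])
  interpret F: module R ?F by fact
  have "(\<lambda>(f, m). f m) \<in> ?S \<rightarrow> carrier V" by (auto simp: hom_module_simps mod_homD)
  from free_module_lift[OF V this] obtain \<phi> where phi: "\<phi> \<in> mod_hom R ?F V"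
    "\<And>f m. f \<in> carrier ?H \<Longrightarrow> m \<in> carrier M \<Longrightarrow> \<phi> (free_basis R ?S (f, m)) = f m"
    unfolding tensor_free_def by (metis (no_types, lifting) SigmaI case_prod_conv)
  note h = mod_homD[OF phi(1)]
  have b: "free_basis R ?S (x, y) \<in> carrier ?F" if "x \<in> carrier ?H" "y \<in> carrier M" for x y
    using that by (simp add: tensor_free_def free_basis_carrier[OF R])
  let ?Z = "{x \<in> carrier ?F. \<phi> x \<in> {\<zero>\<^bsub>V\<^esub>}}"
  have zero: "submodule {\<zero>\<^bsub>V\<^esub>} R V" by (rule V.submoduleI) auto
  have Z: "submodule ?Z R ?F" by (rule preimage_submodule[OF F V phi(1) zero])
  have hc: "f \<in> carrier ?H \<Longrightarrow> m \<in> carrier M \<Longrightarrow> f m \<in> carrier V" for f m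
    by (auto simp: hom_module_simps mod_homD)
  have "tensor_rels R ?H M \<subseteq> ?Z"
    using tensor_rels_carrier[OF H M]
    by (auto simp: tensor_rels_def Let_def mod_hom_minus[OF F V phi(1)] b h phi(2) hc)
       (auto simp: hom_module_simps mod_homD a_minus_def V.r_neg)
  then have "tensor_ker R ?H M \<subseteq> ?Z"
    using Z unfolding tensor_ker_def by (rule hull_minimal)
  then obtain t where t: "t \<in> mod_hom R (tensor_module R ?H M) V"
      "\<And>x. x \<in> carrier ?F \<Longrightarrow> t (tensor_ker R ?H M +>\<^bsub>?F\<^esub> x) = \<phi> x"
    using quot_module_lift[OF F V tensor_ker_submodule[OF H M] phi(1)]
    unfolding tensor_module_def by blast
  moreover have "t (pure_tensor R ?H M f m) = f m" if "f \<in> mod_hom R M V" "m \<in> carrier M" for f m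
    using that t(2)[OF b, of f m] phi(2)[of f m] by (simp add: pure_tensor_def hom_module_simps(1))
  ultimately show ?thesis by blast
qed

lemma tensor_module_generated:
  assumes M: "module R M" and N: "module R N" and H: "submodule H R (tensor_module R M N)"
    and p: "\<And>x y. x \<in> carrier M \<Longrightarrow> y \<in> carrier N \<Longrightarrow> pure_tensor R M N x y \<in> H"
  shows "H = carrier (tensor_module R M N)"
proof -
  let ?F = "tensor_free R M N" let ?K = "tensor_ker R M N" let ?T = "tensor_module R M N"
  interpret M: module R M by fact
  have R: "cring R" by (rule M.is_cring)
  have F: "module R ?F" by (rule tensor_free_module[OF R])
  interpret F: module R ?F by fact
  have K: "submodule ?K R ?F" by (rule tensor_ker_submodule[OF M N])
  interpret K: abelian_subgroup ?K ?F by (rule submodule_abelian_subgroup[OF F K])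
  have T: "module R ?T" by (rule tensor_module_module[OF M N])
  interpret T: module R ?T by fact
  define q where "q = (\<lambda>c\<in>carrier ?F. ?K +>\<^bsub>?F\<^esub> c)"
  have car: "carrier ?T = {?K +>\<^bsub>?F\<^esub> c |c. c \<in> carrier ?F}"
    by (auto simp: tensor_module_def quot_module_simps A_RCOSETS_def')
  have "q \<in> mod_hom R ?F ?T"
    unfolding mod_hom_def
  proof (intro CollectI conjI ballI)
    show "q \<in> carrier ?F \<rightarrow>\<^sub>E carrier ?T" using car by (auto simp: q_def)
  next
    fix c d assume "c \<in> carrier ?F" "d \<in> carrier ?F"
    then show "q (c \<oplus>\<^bsub>?F\<^esub> d) = q c \<oplus>\<^bsub>?T\<^esub> q d"
      by (simp add: q_def tensor_module_def quot_module_simps K.a_rcos_sum)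
  next
    fix a c assume "a \<in> carrier R" "c \<in> carrier ?F"
    then show "q (a \<odot>\<^bsub>?F\<^esub> c) = a \<odot>\<^bsub>?T\<^esub> q c"
      by (simp add: q_def tensor_module_def quot_module_smult[OF F K])
  qed
  from preimage_submodule[OF F T this H] have sub: "submodule {c \<in> carrier ?F. q c \<in> H} R ?F" .
  have "c \<in> {c \<in> carrier ?F. q c \<in> H}" if "c \<in> carrier ?F" for c
  proof (rule free_module_generated[OF R, of _ "carrier M \<times> carrier N"])
    fix z assume z: "z \<in> carrier M \<times> carrier N"
    then have "free_basis R (carrier M \<times> carrier N) z \<in> carrier ?F"
      by (simp add: tensor_free_def free_basis_carrier[OF R])
    then show "free_basis R (carrier M \<times> carrier N) z \<in> {c \<in> carrier ?F. q c \<in> H}"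
      using z p by (auto simp: q_def pure_tensor_def)
  qed (use sub that in \<open>simp_all add: tensor_free_def\<close>)
  then have "carrier ?T \<subseteq> H" unfolding car by (auto simp: q_def)
  then show ?thesis using T.submoduleE(1)[OF H] by blast
qed

lemma trace_map_ex1:
  assumes M: "module R M" and V: "module R V"
  shows "\<exists>!t. t \<in> mod_hom R (tensor_module R (hom_module R M V) M) V \<and>
    (\<forall>f\<in>mod_hom R M V. \<forall>m\<in>carrier M. t (pure_tensor R (hom_module R M V) M f m) = f m)"
proof (rule ex_ex1I)
  show "\<exists>t. t \<in> mod_hom R (tensor_module R (hom_module R M V) M) V \<and>
    (\<forall>f\<in>mod_hom R M V. \<forall>m\<in>carrier M. t (pure_tensor R (hom_module R M V) M f m) = f m)"
    using trace_map_exists[OF M V] by blast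
next
  let ?H = "hom_module R M V" let ?T = "tensor_module R ?H M"
  have H: "module R ?H" by (rule hom_module_module[OF M V])
  have T: "module R ?T" by (rule tensor_module_module[OF H M])
  have p: "pure_tensor R ?H M f m \<in> carrier ?T" if "f \<in> mod_hom R M V" "m \<in> carrier M" for f m
  proof -
    have R: "cring R" using M by (simp add: module_def)
    show ?thesis
      using free_basis_carrier[OF R, of "(f, m)" "carrier ?H \<times> carrier M"] that
      by (auto simp: tensor_module_def quot_module_simps A_RCOSETS_def' pure_tensor_def
          tensor_free_def hom_module_simps(1))
  qed
  fix t t'
  assume t: "t \<in> mod_hom R ?T V \<and>
      (\<forall>f\<in>mod_hom R M V. \<forall>m\<in>carrier M. t (pure_tensor R ?H M f m) = f m)"
    and t': "t' \<in> mod_hom R ?T V \<and>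
      (\<forall>f\<in>mod_hom R M V. \<forall>m\<in>carrier M. t' (pure_tensor R ?H M f m) = f m)"
  have "{c \<in> carrier ?T. t c = t' c} = carrier ?T"
    by (rule tensor_module_generated[OF H M equalizer_submodule[OF T V]])
      (use t t' p in \<open>auto simp: hom_module_simps(1)\<close>)
  then show "t = t'"
    using t t' mod_homD(4) by (intro extensionalityI[of _ "carrier ?T"]) blast+
qed

lemma trace_in_eq_hull:
  assumes M: "module R M" and V: "module R V"
  shows "trace_in R V M =
    (\<lambda>H. submodule H R V) hull {f m |f m. f \<in> mod_hom R M V \<and> m \<in> carrier M}" (is "_ = _ hull ?E")
proof
  let ?H = "hom_module R M V" let ?T = "tensor_module R ?H M"
  have H: "module R ?H" by (rule hom_module_module[OF M V])
  have T: "module R ?T" by (rule tensor_module_module[OF H M])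
  have p: "pure_tensor R ?H M f m \<in> carrier ?T" if "f \<in> mod_hom R M V" "m \<in> carrier M" for f m
  proof -
    have R: "cring R" using M by (simp add: module_def)
    show ?thesis
      using free_basis_carrier[OF R, of "(f, m)" "carrier ?H \<times> carrier M"] that
      by (auto simp: tensor_module_def quot_module_simps A_RCOSETS_def' pure_tensor_def
          tensor_free_def hom_module_simps(1))
  qed
  have t: "trace_map R M V \<in> mod_hom R ?T V"
    "\<And>f m. f \<in> mod_hom R M V \<Longrightarrow> m \<in> carrier M \<Longrightarrow> trace_map R M V (pure_tensor R ?H M f m) = f m"
    using theI'[OF trace_map_ex1[OF M V]] unfolding trace_map_def by blast+
  show "(\<lambda>H. submodule H R V) hull ?E \<subseteq> trace_in R V M"
  proof (rule hull_minimal)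
    show "?E \<subseteq> trace_in R V M"
    proof clarify
      fix f m assume "f \<in> mod_hom R M V" "m \<in> carrier M"
      then show "f m \<in> trace_in R V M"
        unfolding trace_in_def using t(2) p by (metis imageI)
    qed
    show "submodule (trace_in R V M) R V"
      unfolding trace_in_def by (rule image_submodule[OF T V t(1)])
  qed
  have "?E \<subseteq> carrier V" by (auto simp: mod_homD)
  from preimage_submodule[OF T V t(1) hull_submodule[OF V this]]
  have "{c \<in> carrier ?T. trace_map R M V c \<in> (\<lambda>H. submodule H R V) hull ?E} = carrier ?T"
  proof (rule tensor_module_generated[OF H M])
    fix f m assume fm: "f \<in> carrier ?H" "m \<in> carrier M"
    then have "f m \<in> (\<lambda>H. submodule H R V) hull ?E"
      by (intro hull_inc) (auto simp: hom_module_simps(1))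
    then show "pure_tensor R ?H M f m \<in>
        {c \<in> carrier ?T. trace_map R M V c \<in> (\<lambda>H. submodule H R V) hull ?E}"
      using fm t(2) p by (simp add: hom_module_simps(1))
  qed
  then show "trace_in R V M \<subseteq> (\<lambda>H. submodule H R V) hull ?E"
    unfolding trace_in_def by blast
qed

end

theory Submission
  imports Defs
begin

text \<open>Write \<open>V[m]\<close> for the elements of \<open>V\<close> killed by the maximal ideal \<open>m\<close>; these are the
  homogeneous parts of the socle. The three conditions are joined by two intrinsic ones:

  \<^item> whenever \<open>ann x \<subseteq> ann y\<close>, already \<open>y \<in> R x\<close> (\<open>annihilator_reflecting\<close>);

  \<^item> every nonzero element has a nonzero multiple in some \<open>V[m]\<close>, and each \<open>V[m]\<close> has dimension
    at most one over \<open>R / m\<close> (\<open>essential_socle\<close> and \<open>multiplicity_free_socle\<close>).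

  Traces and annihilators. The trace \<open>Y\<close> of a module \<open>M\<close> is stable under every linear map
  \<open>f: Y \<rightarrow> V\<close>, because \<open>f\<close> composed with a map \<open>M \<rightarrow> Y\<close> is again a map \<open>M \<rightarrow> V\<close>. Linear maps on
  \<open>R x\<close> correspond to the \<open>y\<close> with \<open>ann x \<subseteq> ann y\<close>, so if cyclic submodules are traces then
  annihilators are reflected. Conversely, if they are reflected, every linear map \<open>Y \<rightarrow> V\<close> sends
  \<open>u\<close> into \<open>R u \<subseteq> Y\<close>, and \<open>Y\<close> is its own trace.

  Annihilators and socle. If annihilators are reflected and \<open>z\<close> has maximal annihilator among the
  nonzero multiples of \<open>x\<close>, then every nonzero multiple of \<open>z\<close> generates \<open>R z\<close>, so \<open>R z\<close> is simple.
  The converse is the core of the proof (\<open>max_product_multiplication\<close>). It replaces Matlis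
  duality and length counting by linear algebra: the map \<open>x \<mapsto> y\<close> on \<open>R x\<close> is shown to be
  multiplication by a ring element on larger and larger submodules of \<open>R x\<close>, namely the parts
  killed by products of maximal ideals. Passing from the part killed by \<open>J\<close> to the part killed by
  \<open>m J\<close>, the remaining error takes values in \<open>V[m]\<close> and vanishes on the common kernel of the
  multiplications by generators of \<open>J\<close>, which also take values in \<open>V[m]\<close>; as \<open>V[m]\<close> is
  one-dimensional, the error is a linear combination of these multiplications
  (\<open>socle_valued_multiplication\<close>). Noetherian induction shows that some product of maximal ideals
  kills \<open>x\<close> (\<open>max_product_kills\<close>).

  Socle and envelopes. A submodule of the direct sum of the envelopes has the socle property, since
  each envelope \<open>E m\<close> has it with \<open>(E m)[m] \<cong> R / m\<close> as its only homogeneous part. Conversely,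
  embeddings \<open>V[m] \<rightarrow> E m\<close> extend to maps \<open>V \<rightarrow> E m\<close>; together they are injective, because they are
  so on an essential submodule, and they land in the direct sum rather than the product by another
  noetherian induction (\<open>hom_finite_support\<close>).\<close>


section \<open>Annihilators\<close>

definition annihilator ::
    "('a, 'r) ring_scheme \<Rightarrow> ('a, 'b, 'm) module_scheme \<Rightarrow> 'b \<Rightarrow> 'a set"
  where "annihilator R M x = {r \<in> carrier R. r \<odot>\<^bsub>M\<^esub> x = \<zero>\<^bsub>M\<^esub>}"

definition max_torsion ::
    "('a, 'r) ring_scheme \<Rightarrow> ('a, 'b, 'm) module_scheme \<Rightarrow> 'a set \<Rightarrow> 'b set"
  where "max_torsion R M m = {x \<in> carrier M. \<forall>a\<in>m. a \<odot>\<^bsub>M\<^esub> x = \<zero>\<^bsub>M\<^esub>}"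

lemma submodule_zero_closed: "submodule H R M \<Longrightarrow> \<zero>\<^bsub>M\<^esub> \<in> H"
  using subgroup.one_closed[OF submodule.axioms(1)] by fastforce

lemma Max_spec_ideal: "m \<in> Max_spec R \<Longrightarrow> ideal m R"
  by (simp add: Max_spec_def maximalideal.axioms(1))

lemma Max_spec_subset: "m \<in> Max_spec R \<Longrightarrow> a \<in> m \<Longrightarrow> a \<in> carrier R"
  using ideal.Icarr[OF Max_spec_ideal] by metis

lemma Max_spec_one_notin:
  assumes "m \<in> Max_spec R" shows "\<one>\<^bsub>R\<^esub> \<notin> m"
  using assms ideal.one_imp_carrier[OF Max_spec_ideal[OF assms]] maximalideal.I_notcarr
  by (auto simp: Max_spec_def)

lemma Max_spec_eqI:
  assumes "m \<in> Max_spec R" "n \<in> Max_spec R" "m \<subseteq> n"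
  shows "m = n"
proof -
  have "n = m \<or> n = carrier R"
    using assms maximalideal.I_maximal[of m R n] Max_spec_ideal[OF assms(2)] Max_spec_subset[OF assms(2)]
    by (auto simp: Max_spec_def)
  then show ?thesis
    using maximalideal.I_notcarr[of n R] assms(2) by (auto simp: Max_spec_def)
qed

text \<open>Elements outside a maximal ideal are invertible modulo it.\<close>

lemma (in cring) Max_spec_inverse:
  assumes m: "m \<in> Max_spec R" and s: "s \<in> carrier R" "s \<notin> m"
  obtains t where "t \<in> carrier R" "t \<otimes> s \<ominus> \<one> \<in> m"
proof -
  have id: "ideal m R" by (rule Max_spec_ideal[OF m])
  have "ideal (m <+>\<^bsub>R\<^esub> PIdl s) R"
    by (rule add_ideals[OF id cgenideal_ideal[OF s(1)]])
  moreover have sub: "m \<subseteq> m <+>\<^bsub>R\<^esub> PIdl s" "s \<in> m <+>\<^bsub>R\<^esub> PIdl s"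
  proof -
    have z: "\<zero> \<in> m" "\<zero> \<in> PIdl s"
      using additive_subgroup.zero_closed ideal.axioms(1) id cgenideal_ideal[OF s(1)] by blast+
    show "m \<subseteq> m <+>\<^bsub>R\<^esub> PIdl s"
    proof
      fix x assume "x \<in> m"
      then show "x \<in> m <+>\<^bsub>R\<^esub> PIdl s" using z Max_spec_subset[OF m]
        unfolding set_add_def' by (force intro: exI[of _ \<zero>])
    qed
    show "s \<in> m <+>\<^bsub>R\<^esub> PIdl s"
      using z cgenideal_self[OF s(1)] s(1) unfolding set_add_def' by (force intro: exI[of _ \<zero>])
  qed
  ultimately have "m <+>\<^bsub>R\<^esub> PIdl s = carrier R"
    using m s(2) maximalideal.I_maximal[of m R "m <+>\<^bsub>R\<^esub> PIdl s"] ideal.Icarr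
    by (fastforce simp: Max_spec_def)
  then have "\<one> \<in> m <+>\<^bsub>R\<^esub> PIdl s" by simp
  then obtain a t where at: "a \<in> m" "t \<in> carrier R" "\<one> = a \<oplus> t \<otimes> s"
    by (auto simp: set_add_def' cgenideal_def)
  have a: "a \<in> carrier R" using at Max_spec_subset[OF m] by blast
  have "t \<otimes> s \<ominus> \<one> = \<ominus> a" unfolding at(3) using a at(2) s(1) by algebra
  also have "\<dots> \<in> m" using at(1) id by (meson additive_subgroup.a_inv_closed ideal.axioms(1))
  finally show ?thesis using that at(2) by blast
qed

lemma (in noetherian_ring) ideal_family_maximal:
  assumes "S \<noteq> {}" "S \<subseteq> {I. ideal I R}"
  shows "\<exists>I\<in>S. \<forall>J\<in>S. I \<subseteq> J \<longrightarrow> J = I"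
proof (rule subset_Zorn)
  fix C assume C: "subset.chain S C"
  show "\<exists>U\<in>S. \<forall>J\<in>C. J \<subseteq> U"
  proof (cases "C = {}")
    case False
    have "subset.chain {I. ideal I R} C"
      using C assms(2) by (auto simp: subset.chain_def)
    from ideal_chain_is_trivial[OF False this] show ?thesis
      using C by (auto simp: subset.chain_def)
  qed (use assms in auto)
qed

context module
begin

lemma smult_assoc: "a \<in> carrier R \<Longrightarrow> b \<in> carrier R \<Longrightarrow> x \<in> carrier M \<Longrightarrow>
   a \<odot>\<^bsub>M\<^esub> (b \<odot>\<^bsub>M\<^esub> x) = (a \<otimes> b) \<odot>\<^bsub>M\<^esub> x"
  by (simp add: smult_assoc1)

lemma smult_left_commute: "a \<in> carrier R \<Longrightarrow> b \<in> carrier R \<Longrightarrow> x \<in> carrier M \<Longrightarrow>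
   a \<odot>\<^bsub>M\<^esub> (b \<odot>\<^bsub>M\<^esub> x) = b \<odot>\<^bsub>M\<^esub> (a \<odot>\<^bsub>M\<^esub> x)"
  by (simp add: smult_assoc R.m_comm)

lemma smult_r_diff: "a \<in> carrier R \<Longrightarrow> x \<in> carrier M \<Longrightarrow> y \<in> carrier M \<Longrightarrow>
   a \<odot>\<^bsub>M\<^esub> (x \<ominus>\<^bsub>M\<^esub> y) = a \<odot>\<^bsub>M\<^esub> x \<ominus>\<^bsub>M\<^esub> a \<odot>\<^bsub>M\<^esub> y"
  by (simp add: a_minus_def smult_r_distr smult_r_minus)

lemma smult_l_diff: "a \<in> carrier R \<Longrightarrow> b \<in> carrier R \<Longrightarrow> x \<in> carrier M \<Longrightarrow>
   (a \<ominus> b) \<odot>\<^bsub>M\<^esub> x = a \<odot>\<^bsub>M\<^esub> x \<ominus>\<^bsub>M\<^esub> b \<odot>\<^bsub>M\<^esub> x"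
  by (simp add: a_minus_def smult_l_distr smult_l_minus)

lemma diff_eq_zero_iff: "x \<in> carrier M \<Longrightarrow> y \<in> carrier M \<Longrightarrow> x \<ominus>\<^bsub>M\<^esub> y = \<zero>\<^bsub>M\<^esub> \<longleftrightarrow> x = y"
  using M.minus_equality[of x "\<ominus>\<^bsub>M\<^esub> y"] by (auto simp: a_minus_def M.r_neg)

lemma annihilator_ideal:
  assumes "x \<in> carrier M" shows "ideal (annihilator R M x) R"
proof (rule idealI)
  show "ring R" by (rule R.ring_axioms)
  show "subgroup (annihilator R M x) (add_monoid R)"
    by (rule R.add.subgroupI)
       (use assms in \<open>auto simp: annihilator_def smult_l_distr smult_l_minus
         a_inv_def[symmetric] intro!: exI[of _ \<zero>]\<close>)
  fix a b assume "a \<in> annihilator R M x" "b \<in> carrier R"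
  then show "b \<otimes> a \<in> annihilator R M x" "a \<otimes> b \<in> annihilator R M x"
    using assms by (auto simp: annihilator_def smult_assoc1 R.m_comm[of a b])
qed

lemma annihilator_smult_mono:
  assumes "x \<in> carrier M" "a \<in> carrier R"
  shows "annihilator R M x \<subseteq> annihilator R M (a \<odot>\<^bsub>M\<^esub> x)"
  using assms by (auto simp: annihilator_def smult_left_commute[of _ a])

lemma max_torsionI:
  "x \<in> carrier M \<Longrightarrow> (\<And>a. a \<in> m \<Longrightarrow> a \<odot>\<^bsub>M\<^esub> x = \<zero>\<^bsub>M\<^esub>) \<Longrightarrow> x \<in> max_torsion R M m"
  by (simp add: max_torsion_def)

lemma max_torsionD:
  "x \<in> max_torsion R M m \<Longrightarrow> x \<in> carrier M"
  "x \<in> max_torsion R M m \<Longrightarrow> a \<in> m \<Longrightarrow> a \<odot>\<^bsub>M\<^esub> x = \<zero>\<^bsub>M\<^esub>"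
  by (auto simp: max_torsion_def)

lemma max_torsion_submodule:
  assumes "m \<subseteq> carrier R" shows "submodule (max_torsion R M m) R M"
  by (rule submoduleI)
     (use assms in \<open>auto simp: max_torsion_def smult_r_distr smult_r_minus subset_iff
        smult_left_commute\<close>)

lemma max_torsion_annihilator:
  assumes m: "m \<in> Max_spec R" and x: "x \<in> max_torsion R M m" "x \<noteq> \<zero>\<^bsub>M\<^esub>"
  shows "annihilator R M x = m"
proof -
  note xc = max_torsionD(1)[OF x(1)]
  have sub: "m \<subseteq> annihilator R M x"
    using x Max_spec_subset[OF m] by (auto simp: max_torsion_def annihilator_def)
  have "\<one> \<notin> annihilator R M x" using x xc by (simp add: annihilator_def)
  then have ne: "annihilator R M x \<noteq> carrier R" by auto
  have "annihilator R M x \<subseteq> carrier R" by (auto simp: annihilator_def)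
  then show ?thesis
    using maximalideal.I_maximal[of m R, OF _ annihilator_ideal[OF xc] sub] ne m
    by (auto simp: Max_spec_def)
qed

lemma killed_by_genideal:
  assumes "G \<subseteq> carrier R" "x \<in> carrier M" "\<And>g. g \<in> G \<Longrightarrow> g \<odot>\<^bsub>M\<^esub> x = \<zero>\<^bsub>M\<^esub>" "a \<in> Idl G"
  shows "a \<odot>\<^bsub>M\<^esub> x = \<zero>\<^bsub>M\<^esub>"
proof -
  have "Idl G \<subseteq> annihilator R M x"
    using assms by (intro R.genideal_minimal annihilator_ideal) (auto simp: annihilator_def)
  then show ?thesis using assms(4) by (auto simp: annihilator_def)
qed

text \<open>Noetherian induction over the multiples of an element. Passing to a multiple enlarges the
  annihilator, so the hypothesis that the annihilators differ says that it grows strictly; a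
  counterexample with maximal annihilator then contradicts the induction step.\<close>

lemma annihilator_induct:
  assumes noeth: "noetherian_ring R" and x: "x \<in> carrier M"
    and step: "\<And>z. z \<in> carrier M \<Longrightarrow>
      (\<And>a. a \<in> carrier R \<Longrightarrow> annihilator R M z \<noteq> annihilator R M (a \<odot>\<^bsub>M\<^esub> z) \<Longrightarrow> P (a \<odot>\<^bsub>M\<^esub> z)) \<Longrightarrow> P z"
  shows "P x"
proof (rule ccontr)
  assume "\<not> P x"
  define S where "S = {annihilator R M z |z. z \<in> carrier M \<and> \<not> P z}"
  have "S \<noteq> {}" "S \<subseteq> {I. ideal I R}"
    using x \<open>\<not> P x\<close> annihilator_ideal by (auto simp: S_def)
  from noetherian_ring.ideal_family_maximal[OF noeth this]
  obtain z where z: "z \<in> carrier M" "\<not> P z"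
    and max: "\<And>y. y \<in> carrier M \<Longrightarrow> \<not> P y \<Longrightarrow> annihilator R M z \<subseteq> annihilator R M y \<Longrightarrow>
       annihilator R M y = annihilator R M z"
    unfolding S_def by blast
  have "P z"
  proof (rule step[OF z(1)])
    fix a assume "a \<in> carrier R" "annihilator R M z \<noteq> annihilator R M (a \<odot>\<^bsub>M\<^esub> z)"
    then show "P (a \<odot>\<^bsub>M\<^esub> z)" using max[of "a \<odot>\<^bsub>M\<^esub> z"] z annihilator_smult_mono by auto
  qed
  then show False using z by simp
qed


end


section \<open>Modules with essential and multiplicity-free socle\<close>

text \<open>The condition on annihilators says that \<open>x\<close> generates every element to which it can be sent by
  a linear map on \<open>R x\<close>.\<close>

definition annihilator_reflecting ::
    "('a, 'r) ring_scheme \<Rightarrow> ('a, 'b, 'm) module_scheme \<Rightarrow> bool"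
  where "annihilator_reflecting R M \<longleftrightarrow>
    (\<forall>x\<in>carrier M. \<forall>y\<in>carrier M. annihilator R M x \<subseteq> annihilator R M y \<longrightarrow>
      (\<exists>r\<in>carrier R. y = r \<odot>\<^bsub>M\<^esub> x))"

definition essential_socle ::
    "('a, 'r) ring_scheme \<Rightarrow> ('a, 'b, 'm) module_scheme \<Rightarrow> bool"
  where "essential_socle R M \<longleftrightarrow>
    (\<forall>x\<in>carrier M. x \<noteq> \<zero>\<^bsub>M\<^esub> \<longrightarrow>
      (\<exists>m\<in>Max_spec R. \<exists>r\<in>carrier R. r \<odot>\<^bsub>M\<^esub> x \<in> max_torsion R M m \<and> r \<odot>\<^bsub>M\<^esub> x \<noteq> \<zero>\<^bsub>M\<^esub>))"

definition multiplicity_free_socle ::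
    "('a, 'r) ring_scheme \<Rightarrow> ('a, 'b, 'm) module_scheme \<Rightarrow> bool"
  where "multiplicity_free_socle R M \<longleftrightarrow>
    (\<forall>m\<in>Max_spec R. \<forall>x\<in>max_torsion R M m. \<forall>y\<in>max_torsion R M m. x \<noteq> \<zero>\<^bsub>M\<^esub> \<longrightarrow>
      (\<exists>r\<in>carrier R. y = r \<odot>\<^bsub>M\<^esub> x))"

context module
begin

lemma annihilator_reflecting_imp_multiplicity_free:
  assumes "annihilator_reflecting R M" shows "multiplicity_free_socle R M"
  unfolding multiplicity_free_socle_def
proof (intro ballI impI)
  fix m x y
  assume m: "m \<in> Max_spec R" and x: "x \<in> max_torsion R M m" and y: "y \<in> max_torsion R M m"
    and nz: "x \<noteq> \<zero>\<^bsub>M\<^esub>"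
  have "annihilator R M x = m" by (rule max_torsion_annihilator[OF m x nz])
  then have "annihilator R M x \<subseteq> annihilator R M y"
    using y Max_spec_subset[OF m] by (auto simp: max_torsion_def annihilator_def)
  then show "\<exists>r\<in>carrier R. y = r \<odot>\<^bsub>M\<^esub> x"
    using assms max_torsionD(1)[OF x] max_torsionD(1)[OF y] by (auto simp: annihilator_reflecting_def)
qed

text \<open>Noetherian induction pushes the search to a multiple \<open>z\<close> of \<open>x\<close> whose annihilator is that of
  all its nonzero multiples. Then \<open>z\<close> is a multiple of each of them, so \<open>R z\<close> is simple and
  \<open>ann z\<close> is maximal.\<close>

lemma annihilator_reflecting_imp_essential:
  assumes noeth: "noetherian_ring R" and refl: "annihilator_reflecting R M"
  shows "essential_socle R M"
  unfolding essential_socle_def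
proof (intro ballI impI)
  fix x assume "x \<in> carrier M" "x \<noteq> \<zero>\<^bsub>M\<^esub>"
  then show "\<exists>m\<in>Max_spec R. \<exists>r\<in>carrier R. r \<odot>\<^bsub>M\<^esub> x \<in> max_torsion R M m \<and> r \<odot>\<^bsub>M\<^esub> x \<noteq> \<zero>\<^bsub>M\<^esub>"
  proof (induction x rule: annihilator_induct[OF noeth, consumes 1])
    case (1 z)
    show ?case
    proof (cases "\<exists>a\<in>carrier R. a \<odot>\<^bsub>M\<^esub> z \<noteq> \<zero>\<^bsub>M\<^esub> \<and> annihilator R M z \<noteq> annihilator R M (a \<odot>\<^bsub>M\<^esub> z)")
      case True
      then obtain a where a: "a \<in> carrier R" "a \<odot>\<^bsub>M\<^esub> z \<noteq> \<zero>\<^bsub>M\<^esub>"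
        "annihilator R M z \<noteq> annihilator R M (a \<odot>\<^bsub>M\<^esub> z)" by blast
      from 1(2)[OF a(1,3,2)] obtain m r where mr: "m \<in> Max_spec R" "r \<in> carrier R"
        "r \<odot>\<^bsub>M\<^esub> (a \<odot>\<^bsub>M\<^esub> z) \<in> max_torsion R M m" "r \<odot>\<^bsub>M\<^esub> (a \<odot>\<^bsub>M\<^esub> z) \<noteq> \<zero>\<^bsub>M\<^esub>" by blast
      then show ?thesis
        using a(1) 1(1) by (intro bexI[of _ m] bexI[of _ "r \<otimes> a"]) (simp_all add: smult_assoc1)
    next
      case False
      let ?p = "annihilator R M z"
      have "\<one> \<notin> ?p" using 1 by (simp add: annihilator_def)
      have "maximalideal ?p R"
      proof (rule maximalidealI)
        show "ideal ?p R" by (rule annihilator_ideal[OF 1(1)])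
        show "carrier R \<noteq> ?p" using \<open>\<one> \<notin> ?p\<close> by auto
        fix J assume J: "ideal J R" "?p \<subseteq> J" "J \<subseteq> carrier R"
        show "J = ?p \<or> J = carrier R"
        proof (cases "J = ?p")
          case False
          then obtain a where a: "a \<in> J" "a \<notin> ?p" using J by blast
          then have ac: "a \<in> carrier R" using J by blast
          then have "a \<odot>\<^bsub>M\<^esub> z \<noteq> \<zero>\<^bsub>M\<^esub>" using a(2) by (simp add: annihilator_def)
          then have "annihilator R M (a \<odot>\<^bsub>M\<^esub> z) \<subseteq> annihilator R M z" using \<open>\<not> (\<exists>a\<in>carrier R. _ a)\<close> ac by auto
          then obtain r where r: "r \<in> carrier R" "z = r \<odot>\<^bsub>M\<^esub> (a \<odot>\<^bsub>M\<^esub> z)"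
            using refl 1(1) ac unfolding annihilator_reflecting_def by (meson smult_closed)
          have "(\<one> \<ominus> r \<otimes> a) \<odot>\<^bsub>M\<^esub> z = \<zero>\<^bsub>M\<^esub>"
            using r ac 1(1) by (simp add: smult_l_diff smult_assoc1 diff_eq_zero_iff)
          then have "\<one> \<ominus> r \<otimes> a \<in> ?p" using r(1) ac by (simp add: annihilator_def)
          then have "\<one> \<ominus> r \<otimes> a \<in> J" using J(2) by blast
          moreover have "r \<otimes> a \<in> J" using J(1) a(1) r(1) by (simp add: ideal.I_l_closed)
          ultimately have "(\<one> \<ominus> r \<otimes> a) \<oplus> r \<otimes> a \<in> J"
            by (rule additive_subgroup.a_closed[OF ideal.axioms(1)[OF J(1)]])
          moreover have "(\<one> \<ominus> r \<otimes> a) \<oplus> r \<otimes> a = \<one>" using r(1) ac by algebra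
          ultimately have "J = carrier R" using ideal.one_imp_carrier[OF J(1)] by simp
          then show ?thesis ..
        qed simp
      qed
      moreover have "\<one> \<odot>\<^bsub>M\<^esub> z \<in> max_torsion R M ?p"
        using 1(1) by (simp add: max_torsion_def annihilator_def)
      ultimately show ?thesis
        using 1(1,3) by (intro bexI[of _ ?p] bexI[of _ \<one>]) (auto simp: Max_spec_def)
    qed
  qed
qed

text \<open>When the socle is essential, noetherian induction can be run along maximal ideals: if \<open>r z\<close> is
  nonzero and killed by \<open>m\<close>, then \<open>r\<close> kills \<open>a z\<close> for every \<open>a \<in> m\<close> but does not kill \<open>z\<close>, so
  all the elements of \<open>m z\<close> have strictly larger annihilators than \<open>z\<close>.\<close>

lemma socle_induct:
  assumes noeth: "noetherian_ring R" and ess: "essential_socle R M" and x: "x \<in> carrier M"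
    and zero: "P \<zero>\<^bsub>M\<^esub>"
    and step: "\<And>z m. z \<in> carrier M \<Longrightarrow> m \<in> Max_spec R \<Longrightarrow> (\<And>a. a \<in> m \<Longrightarrow> P (a \<odot>\<^bsub>M\<^esub> z)) \<Longrightarrow> P z"
  shows "P x"
  using x
proof (induction x rule: annihilator_induct[OF noeth, consumes 1])
  case (1 z)
  show ?case
  proof (cases "z = \<zero>\<^bsub>M\<^esub>")
    case False
    with 1(1) ess obtain m r where m: "m \<in> Max_spec R" and r: "r \<in> carrier R"
      "r \<odot>\<^bsub>M\<^esub> z \<in> max_torsion R M m" "r \<odot>\<^bsub>M\<^esub> z \<noteq> \<zero>\<^bsub>M\<^esub>"
      unfolding essential_socle_def by blast
    show ?thesis
    proof (rule step[OF 1(1) m])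
      fix a assume a: "a \<in> m"
      have ac: "a \<in> carrier R" by (rule Max_spec_subset[OF m a])
      have "r \<odot>\<^bsub>M\<^esub> (a \<odot>\<^bsub>M\<^esub> z) = \<zero>\<^bsub>M\<^esub>"
        using max_torsionD(2)[OF r(2) a] smult_left_commute[OF r(1) ac 1(1)] by simp
      then have "r \<in> annihilator R M (a \<odot>\<^bsub>M\<^esub> z)" "r \<notin> annihilator R M z"
        using r by (auto simp: annihilator_def)
      then show "P (a \<odot>\<^bsub>M\<^esub> z)" using 1(2)[OF ac] by blast
    qed
  qed (use zero in simp)
qed

text \<open>A linear functional that vanishes on the common kernel of finitely many functionals is a
  linear combination of them. Here the functionals live on \<open>D x\<close>: they are the multiplications by
  the elements of \<open>A\<close> and the map \<open>s x \<mapsto> s w\<close>, all with values in \<open>M[m]\<close>, which is at most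
  one-dimensional. Working with the ideal \<open>D\<close> of scalars instead of the submodule \<open>D x\<close> spares
  the choice of preimages. The induction removes one functional \<open>a\<close> from \<open>A\<close> and restricts the
  others to its kernel.\<close>

lemma socle_valued_multiplication:
  assumes free: "multiplicity_free_socle R M" and m: "m \<in> Max_spec R"
    and x: "x \<in> carrier M" and w: "w \<in> carrier M"
    and A: "finite A" "A \<subseteq> carrier R" and D: "ideal D R"
    and Dw: "\<And>s. s \<in> D \<Longrightarrow> s \<odot>\<^bsub>M\<^esub> w \<in> max_torsion R M m"
    and Dx: "\<And>s a. s \<in> D \<Longrightarrow> a \<in> A \<Longrightarrow> a \<odot>\<^bsub>M\<^esub> (s \<odot>\<^bsub>M\<^esub> x) \<in> max_torsion R M m"
    and ker: "\<And>s. s \<in> D \<Longrightarrow> (\<And>a. a \<in> A \<Longrightarrow> a \<odot>\<^bsub>M\<^esub> (s \<odot>\<^bsub>M\<^esub> x) = \<zero>\<^bsub>M\<^esub>) \<Longrightarrow> s \<odot>\<^bsub>M\<^esub> w = \<zero>\<^bsub>M\<^esub>"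
  shows "\<exists>r\<in>Idl A. \<forall>s\<in>D. s \<odot>\<^bsub>M\<^esub> w = r \<odot>\<^bsub>M\<^esub> (s \<odot>\<^bsub>M\<^esub> x)"
  using A D Dw Dx ker
proof (induction A arbitrary: D rule: finite_induct)
  case empty
  have "\<zero> \<in> Idl {}" by (meson R.genideal_ideal additive_subgroup.zero_closed empty_subsetI ideal.axioms(1))
  moreover have "\<forall>s\<in>D. s \<odot>\<^bsub>M\<^esub> w = \<zero> \<odot>\<^bsub>M\<^esub> (s \<odot>\<^bsub>M\<^esub> x)"
    using empty x ideal.Icarr[OF \<open>ideal D R\<close>] by simp
  ultimately show ?case by blast
next
  case (insert a A)
  note Dc = ideal.Icarr[OF \<open>ideal D R\<close>]
  have ac: "a \<in> carrier R" and Ac: "A \<subseteq> carrier R" using insert.prems by auto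
  note mc = Max_spec_subset[OF m]
  interpret D: ideal D R by fact
  interpret IA: ideal "Idl (insert a A)" R using R.genideal_ideal insert.prems(1) by blast
  have IAsub: "Idl A \<subseteq> Idl (insert a A)"
    using R.genideal_self[OF insert.prems(1)] by (intro R.genideal_minimal IA.is_ideal) auto
  \<comment> \<open>The scalars whose multiple of \<open>x\<close> lies in the kernel of the functional \<open>a\<close>.\<close>
  define D0 where "D0 = D \<inter> annihilator R M (a \<odot>\<^bsub>M\<^esub> x)"
  have memD0: "s \<in> D0 \<longleftrightarrow> s \<in> D \<and> a \<odot>\<^bsub>M\<^esub> (s \<odot>\<^bsub>M\<^esub> x) = \<zero>\<^bsub>M\<^esub>" for s
    using Dc ac x by (auto simp: D0_def annihilator_def smult_left_commute[of a])
  have "ideal D0 R" unfolding D0_def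
    using ac x by (intro R.i_intersect D.is_ideal annihilator_ideal) simp
  from insert.IH[OF Ac this]
  have "\<exists>r\<in>Idl A. \<forall>s\<in>D0. s \<odot>\<^bsub>M\<^esub> w = r \<odot>\<^bsub>M\<^esub> (s \<odot>\<^bsub>M\<^esub> x)"
  proof
    fix s assume s: "s \<in> D0" "\<And>b. b \<in> A \<Longrightarrow> b \<odot>\<^bsub>M\<^esub> (s \<odot>\<^bsub>M\<^esub> x) = \<zero>\<^bsub>M\<^esub>"
    then show "s \<odot>\<^bsub>M\<^esub> w = \<zero>\<^bsub>M\<^esub>" using insert.prems(5)[of s] memD0 by blast
  qed (use insert.prems(3,4) memD0 in auto)
  then obtain r where r: "r \<in> Idl A" "\<And>s. s \<in> D0 \<Longrightarrow> s \<odot>\<^bsub>M\<^esub> w = r \<odot>\<^bsub>M\<^esub> (s \<odot>\<^bsub>M\<^esub> x)" by blast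
  have rc: "r \<in> carrier R" using r(1) IAsub IA.Icarr by blast
  define w' where "w' = w \<ominus>\<^bsub>M\<^esub> r \<odot>\<^bsub>M\<^esub> x"
  have w'c: "w' \<in> carrier M" using w rc x by (simp add: w'_def)
  have sw': "s \<odot>\<^bsub>M\<^esub> w' = s \<odot>\<^bsub>M\<^esub> w \<ominus>\<^bsub>M\<^esub> r \<odot>\<^bsub>M\<^esub> (s \<odot>\<^bsub>M\<^esub> x)" if "s \<in> carrier R" for s
    using that w rc x by (simp add: w'_def smult_r_diff smult_left_commute[of s r])
  have w'D0: "s \<odot>\<^bsub>M\<^esub> w' = \<zero>\<^bsub>M\<^esub>" if "s \<in> D0" for s
  proof -
    have sc: "s \<in> carrier R" using that memD0 Dc by blast
    show ?thesis using sw'[OF sc] r(2)[OF that] sc rc x by (simp add: diff_eq_zero_iff)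
  qed
  show ?case
  proof (cases "D0 = D")
    case True
    then show ?thesis using r IAsub by blast
  next
    case False
    then obtain z where z: "z \<in> D" "a \<odot>\<^bsub>M\<^esub> (z \<odot>\<^bsub>M\<^esub> x) \<noteq> \<zero>\<^bsub>M\<^esub>" using memD0 by blast
    have zc: "z \<in> carrier R" by (rule Dc[OF z(1)])
    let ?e = "a \<odot>\<^bsub>M\<^esub> (z \<odot>\<^bsub>M\<^esub> x)"
    have e: "?e \<in> max_torsion R M m" using insert.prems(4)[OF z(1)] by simp
    have span: "\<exists>u\<in>carrier R. v = u \<odot>\<^bsub>M\<^esub> ?e" if "v \<in> max_torsion R M m" for v
      using free m e z(2) that unfolding multiplicity_free_socle_def by blast
    \<comment> \<open>Since \<open>m z \<subseteq> D0\<close>, the corrected map \<open>s x \<mapsto> s w'\<close> sends \<open>z x\<close> into \<open>M[m]\<close>, and there its value is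
      \<open>t\<close> times that of \<open>a\<close>; adding \<open>t a\<close> to \<open>r\<close> therefore corrects it on all of \<open>D\<close>.\<close>
    have "z \<odot>\<^bsub>M\<^esub> w' \<in> max_torsion R M m"
    proof (rule max_torsionI)
      fix g assume g: "g \<in> m"
      then have gc: "g \<in> carrier R" by (rule mc)
      have "g \<otimes> z \<in> D0" using z(1) gc zc ac x max_torsionD(2)[OF e g]
        by (simp add: memD0 D.I_l_closed smult_assoc1 smult_left_commute[of a g])
      from w'D0[OF this] show "g \<odot>\<^bsub>M\<^esub> (z \<odot>\<^bsub>M\<^esub> w') = \<zero>\<^bsub>M\<^esub>" using gc zc w'c by (simp add: smult_assoc1)
    qed (use zc w'c in simp)
    then obtain t where t: "t \<in> carrier R" "z \<odot>\<^bsub>M\<^esub> w' = t \<odot>\<^bsub>M\<^esub> ?e" using span by blast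
    have "s \<odot>\<^bsub>M\<^esub> w = (r \<oplus> t \<otimes> a) \<odot>\<^bsub>M\<^esub> (s \<odot>\<^bsub>M\<^esub> x)" if s: "s \<in> D" for s
    proof -
      have sc: "s \<in> carrier R" by (rule Dc[OF s])
      obtain u where u: "u \<in> carrier R" "a \<odot>\<^bsub>M\<^esub> (s \<odot>\<^bsub>M\<^esub> x) = u \<odot>\<^bsub>M\<^esub> ?e"
        using span[of "a \<odot>\<^bsub>M\<^esub> (s \<odot>\<^bsub>M\<^esub> x)"] insert.prems(4)[OF s] by auto
      have "s \<ominus> u \<otimes> z \<in> D" using s z(1) u(1)
        by (simp add: a_minus_def D.I_l_closed D.a_closed)
      moreover have "a \<odot>\<^bsub>M\<^esub> ((s \<ominus> u \<otimes> z) \<odot>\<^bsub>M\<^esub> x) = \<zero>\<^bsub>M\<^esub>"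
        using u sc zc ac x by (simp add: smult_l_diff smult_r_diff smult_assoc1 diff_eq_zero_iff smult_left_commute[of a u])
      ultimately have "(s \<ominus> u \<otimes> z) \<odot>\<^bsub>M\<^esub> w' = \<zero>\<^bsub>M\<^esub>" using w'D0 memD0 by blast
      then have "s \<odot>\<^bsub>M\<^esub> w' = u \<odot>\<^bsub>M\<^esub> (z \<odot>\<^bsub>M\<^esub> w')"
        using u(1) sc zc w'c by (simp add: smult_l_diff smult_assoc1 diff_eq_zero_iff)
      also have "\<dots> = t \<odot>\<^bsub>M\<^esub> (a \<odot>\<^bsub>M\<^esub> (s \<odot>\<^bsub>M\<^esub> x))"
        using t u ac zc x by (simp add: smult_left_commute[of t u])
      finally have "s \<odot>\<^bsub>M\<^esub> w \<ominus>\<^bsub>M\<^esub> r \<odot>\<^bsub>M\<^esub> (s \<odot>\<^bsub>M\<^esub> x) = t \<odot>\<^bsub>M\<^esub> (a \<odot>\<^bsub>M\<^esub> (s \<odot>\<^bsub>M\<^esub> x))"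
        using sw'[OF sc] by simp
      moreover have "s \<odot>\<^bsub>M\<^esub> w = r \<odot>\<^bsub>M\<^esub> (s \<odot>\<^bsub>M\<^esub> x) \<oplus>\<^bsub>M\<^esub> (s \<odot>\<^bsub>M\<^esub> w \<ominus>\<^bsub>M\<^esub> r \<odot>\<^bsub>M\<^esub> (s \<odot>\<^bsub>M\<^esub> x))"
        using sc w rc x by (simp add: a_minus_def M.a_lcomm[of _ "s \<odot>\<^bsub>M\<^esub> w"] M.r_neg)
      ultimately show ?thesis
        using rc t(1) ac sc x by (simp add: smult_l_distr smult_assoc1)
    qed
    moreover have "r \<oplus> t \<otimes> a \<in> Idl (insert a A)"
      using r(1) IAsub R.genideal_self[OF insert.prems(1)] t(1) by (auto intro!: IA.a_closed IA.I_l_closed)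
    ultimately show ?thesis by blast
  qed
qed

end

text \<open>The sets with this property are finite generating sets of the products of maximal ideals; having
  finitely many generators is what the linear algebra needs.\<close>

inductive max_product :: "('a, 'r) ring_scheme \<Rightarrow> 'a set \<Rightarrow> bool" for R
  where one: "max_product R {\<one>\<^bsub>R\<^esub>}"
  | times: "max_product R A \<Longrightarrow> finite G \<Longrightarrow> G \<subseteq> carrier R \<Longrightarrow> Idl\<^bsub>R\<^esub> G \<in> Max_spec R \<Longrightarrow>
      max_product R (G <#>\<^bsub>R\<^esub> A)"

lemma (in cring) max_product_finite:
  assumes "max_product R A" shows "finite A" "A \<subseteq> carrier R"
  using assms by (induction rule: max_product.induct) (auto simp: set_mult_def)

lemma (in cring) max_product_mult:
  assumes "max_product R A" "max_product R B"
  shows "max_product R (A <#> B)"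
  using assms(1)
proof (induction rule: max_product.induct)
  case one
  have "{\<one>} <#> B = B"
    using max_product_finite(2)[OF assms(2)] by (force simp: set_mult_def)
  then show ?case using assms(2) by simp
next
  case (times A G)
  have "G <#> A <#> B = G <#> (A <#> B)"
  proof -
    have "g \<otimes> a \<otimes> b = g \<otimes> (a \<otimes> b)" if "g \<in> G" "a \<in> A" "b \<in> B" for g a b
      using that max_product_finite(2)[OF times(1)] max_product_finite(2)[OF assms(2)] times(3)
      by (intro m_assoc) auto
    then show ?thesis by (simp add: set_mult_def)
  qed
  then show ?case using max_product.times[OF times.IH times.hyps(2-)] by simp
qed

context module
begin

text \<open>If every generator of \<open>m\<close> sends \<open>z\<close> to an element killed by a product of maximal ideals, then
  the product of these finitely many products kills all of \<open>m z\<close>, and a further factor \<open>m\<close> kills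
  \<open>z\<close>.\<close>

lemma max_product_kills:
  assumes noeth: "noetherian_ring R" and ess: "essential_socle R M" and x: "x \<in> carrier M"
  shows "\<exists>A. max_product R A \<and> (\<forall>a\<in>A. a \<odot>\<^bsub>M\<^esub> x = \<zero>\<^bsub>M\<^esub>)"
proof (rule socle_induct[OF noeth ess x])
  show "\<exists>A. max_product R A \<and> (\<forall>a\<in>A. a \<odot>\<^bsub>M\<^esub> \<zero>\<^bsub>M\<^esub> = \<zero>\<^bsub>M\<^esub>)"
    using max_product.one by force
next
  fix z m assume z: "z \<in> carrier M" and m: "m \<in> Max_spec R"
    and IH: "\<And>a. a \<in> m \<Longrightarrow> \<exists>A. max_product R A \<and> (\<forall>b\<in>A. b \<odot>\<^bsub>M\<^esub> (a \<odot>\<^bsub>M\<^esub> z) = \<zero>\<^bsub>M\<^esub>)"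
  obtain G where G: "G \<subseteq> carrier R" "finite G" "m = Idl G"
    using noetherian_ring.finetely_gen[OF noeth Max_spec_ideal[OF m]] by blast
  have "G \<subseteq> m" using G R.genideal_self by blast
  have "\<exists>A. max_product R A \<and> (\<forall>g\<in>G. \<forall>b\<in>A. b \<odot>\<^bsub>M\<^esub> (g \<odot>\<^bsub>M\<^esub> z) = \<zero>\<^bsub>M\<^esub>)"
    using G(2,1) \<open>G \<subseteq> m\<close>
  proof (induction G rule: finite_induct)
    case empty
    then show ?case using max_product.one by blast
  next
    case (insert g G)
    then obtain A where A: "max_product R A" "\<And>h b. h \<in> G \<Longrightarrow> b \<in> A \<Longrightarrow> b \<odot>\<^bsub>M\<^esub> (h \<odot>\<^bsub>M\<^esub> z) = \<zero>\<^bsub>M\<^esub>"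
      by auto
    obtain B where B: "max_product R B" "\<And>b. b \<in> B \<Longrightarrow> b \<odot>\<^bsub>M\<^esub> (g \<odot>\<^bsub>M\<^esub> z) = \<zero>\<^bsub>M\<^esub>"
      using IH[of g] insert.prems by auto
    note c = subsetD[OF R.max_product_finite(2)[OF A(1)]] subsetD[OF R.max_product_finite(2)[OF B(1)]]
    have "(a \<otimes> b) \<odot>\<^bsub>M\<^esub> (h \<odot>\<^bsub>M\<^esub> z) = \<zero>\<^bsub>M\<^esub>" if "h \<in> insert g G" "a \<in> A" "b \<in> B" for a b h
    proof -
      have hc: "h \<odot>\<^bsub>M\<^esub> z \<in> carrier M" using that insert.prems z by auto
      have "a \<odot>\<^bsub>M\<^esub> (b \<odot>\<^bsub>M\<^esub> (h \<odot>\<^bsub>M\<^esub> z)) = \<zero>\<^bsub>M\<^esub>"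
      proof (cases "h = g")
        case True
        then show ?thesis using B(2)[OF that(3)] c(1)[OF that(2)] by simp
      next
        case False
        then have "a \<odot>\<^bsub>M\<^esub> (h \<odot>\<^bsub>M\<^esub> z) = \<zero>\<^bsub>M\<^esub>" using A(2) that by auto
        then show ?thesis
          using smult_left_commute[OF c(1)[OF that(2)] c(2)[OF that(3)] hc] c(2)[OF that(3)] by simp
      qed
      then show ?thesis using c(1)[OF that(2)] c(2)[OF that(3)] hc by (simp add: smult_assoc1)
    qed
    then show ?case
      using R.max_product_mult[OF A(1) B(1)] by (intro exI[of _ "A <#> B"]) (auto simp: set_mult_def)
  qed
  then obtain A where A: "max_product R A" "\<And>g b. g \<in> G \<Longrightarrow> b \<in> A \<Longrightarrow> b \<odot>\<^bsub>M\<^esub> (g \<odot>\<^bsub>M\<^esub> z) = \<zero>\<^bsub>M\<^esub>"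
    by blast
  have "max_product R (G <#> A)" using max_product.times[OF A(1) G(2,1)] m G(3) by simp
  moreover have "(g \<otimes> b) \<odot>\<^bsub>M\<^esub> z = \<zero>\<^bsub>M\<^esub>" if "g \<in> G" "b \<in> A" for g b
  proof -
    have "g \<in> carrier R" "b \<in> carrier R" using that G(1) R.max_product_finite(2)[OF A(1)] by auto
    then show ?thesis using A(2)[OF that] z by (simp add: smult_assoc1 smult_left_commute[of g b])
  qed
  ultimately show "\<exists>A. max_product R A \<and> (\<forall>a\<in>A. a \<odot>\<^bsub>M\<^esub> z = \<zero>\<^bsub>M\<^esub>)"
    by (intro exI[of _ "G <#> A"]) (auto simp: set_mult_def)
qed

text \<open>On the part of \<open>R x\<close> that is killed by \<open>A\<close>, the linear map \<open>x \<mapsto> y\<close> is multiplication by a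
  ring element. If \<open>r\<close> works for \<open>A\<close>, then on the part killed by \<open>m A\<close> the error \<open>w = y - r x\<close>
  gives a map into \<open>M[m]\<close> that vanishes on the part killed by \<open>A\<close>, which is the situation of
  \<open>socle_valued_multiplication\<close>.\<close>

lemma max_product_multiplication:
  assumes free: "multiplicity_free_socle R M" and x: "x \<in> carrier M" and y: "y \<in> carrier M"
    and ann: "annihilator R M x \<subseteq> annihilator R M y" and A: "max_product R A"
  shows "\<exists>r\<in>carrier R. \<forall>s\<in>carrier R. (\<forall>a\<in>A. a \<odot>\<^bsub>M\<^esub> (s \<odot>\<^bsub>M\<^esub> x) = \<zero>\<^bsub>M\<^esub>) \<longrightarrow>
    s \<odot>\<^bsub>M\<^esub> y = r \<odot>\<^bsub>M\<^esub> (s \<odot>\<^bsub>M\<^esub> x)"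
  using A
proof (induction rule: max_product.induct)
  case one
  show ?case
    using x y ann by (intro bexI[of _ \<zero>]) (auto simp: annihilator_def)
next
  case (times A G)
  let ?m = "Idl G"
  note Ac = R.max_product_finite[OF times.hyps(1)]
  note Gc = times.hyps(3) and m = times.hyps(4)
  note mc = Max_spec_subset[OF m]
  from times.IH obtain r where r: "r \<in> carrier R"
    "\<And>s. s \<in> carrier R \<Longrightarrow> (\<And>a. a \<in> A \<Longrightarrow> a \<odot>\<^bsub>M\<^esub> (s \<odot>\<^bsub>M\<^esub> x) = \<zero>\<^bsub>M\<^esub>) \<Longrightarrow> s \<odot>\<^bsub>M\<^esub> y = r \<odot>\<^bsub>M\<^esub> (s \<odot>\<^bsub>M\<^esub> x)"
    by blast
  define w where "w = y \<ominus>\<^bsub>M\<^esub> r \<odot>\<^bsub>M\<^esub> x"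
  have wc: "w \<in> carrier M" using x y r(1) by (simp add: w_def)
  have sw: "s \<odot>\<^bsub>M\<^esub> w = s \<odot>\<^bsub>M\<^esub> y \<ominus>\<^bsub>M\<^esub> r \<odot>\<^bsub>M\<^esub> (s \<odot>\<^bsub>M\<^esub> x)" if "s \<in> carrier R" for s
    using that x y r(1) by (simp add: w_def smult_r_diff smult_left_commute[of s r])
  have w0: "s \<odot>\<^bsub>M\<^esub> w = \<zero>\<^bsub>M\<^esub>" if "s \<in> carrier R" "\<And>a. a \<in> A \<Longrightarrow> a \<odot>\<^bsub>M\<^esub> (s \<odot>\<^bsub>M\<^esub> x) = \<zero>\<^bsub>M\<^esub>" for s
    using sw[OF that(1)] r(2)[OF that] r(1) that(1) x by (simp add: diff_eq_zero_iff)
  \<comment> \<open>The scalars \<open>s\<close> for which \<open>G <#> A\<close> kills \<open>s x\<close>. The extra \<open>\<zero>\<close> keeps the family nonempty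
    and contributes the whole ring.\<close>
  define D where "D = (\<Inter>b\<in>insert \<zero> (G <#> A). annihilator R M (b \<odot>\<^bsub>M\<^esub> x))"
  have GAc: "b \<in> carrier R" if "b \<in> G <#> A" for b
    using that Gc Ac by (auto simp: set_mult_def)
  have D: "ideal D R"
    unfolding D_def using GAc x by (intro R.i_Intersect) (auto intro!: annihilator_ideal)
  have Dc: "s \<in> carrier R" if "s \<in> D" for s using ideal.Icarr[OF D that] .
  have memD: "s \<in> D \<longleftrightarrow> s \<in> carrier R \<and> (\<forall>b\<in>G <#> A. b \<odot>\<^bsub>M\<^esub> (s \<odot>\<^bsub>M\<^esub> x) = \<zero>\<^bsub>M\<^esub>)" for s
    using GAc x by (auto simp: D_def annihilator_def smult_left_commute[of s])
  have Dx: "a \<odot>\<^bsub>M\<^esub> (s \<odot>\<^bsub>M\<^esub> x) \<in> max_torsion R M ?m" if s: "s \<in> D" and a: "a \<in> A" for s a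
  proof (rule max_torsionI)
    have c: "s \<in> carrier R" "a \<in> carrier R" using Dc s a Ac by auto
    then show xc: "a \<odot>\<^bsub>M\<^esub> (s \<odot>\<^bsub>M\<^esub> x) \<in> carrier M" using x by simp
    fix h assume "h \<in> ?m"
    then show "h \<odot>\<^bsub>M\<^esub> (a \<odot>\<^bsub>M\<^esub> (s \<odot>\<^bsub>M\<^esub> x)) = \<zero>\<^bsub>M\<^esub>"
    proof (rule killed_by_genideal[OF Gc xc, rotated])
      fix g assume g: "g \<in> G"
      then have "g \<otimes> a \<in> G <#> A" using a by (auto simp: set_mult_def)
      then have "(g \<otimes> a) \<odot>\<^bsub>M\<^esub> (s \<odot>\<^bsub>M\<^esub> x) = \<zero>\<^bsub>M\<^esub>" using s memD by blast
      moreover have "g \<in> carrier R" using g Gc by blast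
      ultimately show "g \<odot>\<^bsub>M\<^esub> (a \<odot>\<^bsub>M\<^esub> (s \<odot>\<^bsub>M\<^esub> x)) = \<zero>\<^bsub>M\<^esub>" using c x by (simp add: smult_assoc1)
    qed
  qed
  have Dw: "s \<odot>\<^bsub>M\<^esub> w \<in> max_torsion R M ?m" if s: "s \<in> D" for s
  proof (rule max_torsionI)
    have c: "s \<in> carrier R" using Dc s by auto
    then show "s \<odot>\<^bsub>M\<^esub> w \<in> carrier M" using wc by simp
    fix h assume h: "h \<in> ?m"
    have hc: "h \<in> carrier R" by (rule mc[OF h])
    have "(h \<otimes> s) \<odot>\<^bsub>M\<^esub> w = \<zero>\<^bsub>M\<^esub>"
    proof (rule w0)
      fix a assume a: "a \<in> A"
      then have "a \<in> carrier R" using Ac by blast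
      then show "a \<odot>\<^bsub>M\<^esub> ((h \<otimes> s) \<odot>\<^bsub>M\<^esub> x) = \<zero>\<^bsub>M\<^esub>"
        using max_torsionD(2)[OF Dx[OF s a] h] hc c x by (simp add: smult_assoc1 smult_left_commute[of a h])
    qed (use hc c in simp)
    then show "h \<odot>\<^bsub>M\<^esub> (s \<odot>\<^bsub>M\<^esub> w) = \<zero>\<^bsub>M\<^esub>" using hc c wc by (simp add: smult_assoc1)
  qed
  have "\<exists>r'\<in>Idl A. \<forall>s\<in>D. s \<odot>\<^bsub>M\<^esub> w = r' \<odot>\<^bsub>M\<^esub> (s \<odot>\<^bsub>M\<^esub> x)"
    by (rule socle_valued_multiplication[OF free m x wc Ac D Dw Dx]) (use w0 Dc in auto)
  then obtain r' where r': "r' \<in> Idl A" "\<And>s. s \<in> D \<Longrightarrow> s \<odot>\<^bsub>M\<^esub> w = r' \<odot>\<^bsub>M\<^esub> (s \<odot>\<^bsub>M\<^esub> x)" by blast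
  have r'c: "r' \<in> carrier R" using ideal.Icarr[OF R.genideal_ideal[OF Ac(2)] r'(1)] .
  show ?case
  proof (intro bexI[of _ "r \<oplus> r'"] ballI impI)
    fix s assume s: "s \<in> carrier R" "\<forall>a\<in>G <#> A. a \<odot>\<^bsub>M\<^esub> (s \<odot>\<^bsub>M\<^esub> x) = \<zero>\<^bsub>M\<^esub>"
    then have "s \<in> D" using memD by blast
    have "s \<odot>\<^bsub>M\<^esub> y = r \<odot>\<^bsub>M\<^esub> (s \<odot>\<^bsub>M\<^esub> x) \<oplus>\<^bsub>M\<^esub> s \<odot>\<^bsub>M\<^esub> w"
      using s x y r(1) by (simp add: sw a_minus_def M.a_lcomm[of _ "s \<odot>\<^bsub>M\<^esub> y"] M.r_neg)
    then show "s \<odot>\<^bsub>M\<^esub> y = (r \<oplus> r') \<odot>\<^bsub>M\<^esub> (s \<odot>\<^bsub>M\<^esub> x)"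
      using r'(2)[OF \<open>s \<in> D\<close>] s r(1) r'c x by (simp add: smult_l_distr)
  qed (use r(1) r'c in simp)
qed

theorem annihilator_reflecting_iff_socle:
  assumes noeth: "noetherian_ring R"
  shows "annihilator_reflecting R M \<longleftrightarrow> essential_socle R M \<and> multiplicity_free_socle R M"
proof (intro iffI conjI)
  assume soc: "essential_socle R M \<and> multiplicity_free_socle R M"
  show "annihilator_reflecting R M"
    unfolding annihilator_reflecting_def
  proof (intro ballI impI)
    fix x y assume xy: "x \<in> carrier M" "y \<in> carrier M" "annihilator R M x \<subseteq> annihilator R M y"
    obtain A where A: "max_product R A" "\<And>a. a \<in> A \<Longrightarrow> a \<odot>\<^bsub>M\<^esub> x = \<zero>\<^bsub>M\<^esub>"
      using max_product_kills[OF noeth _ xy(1)] soc by blast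
    obtain r where "r \<in> carrier R" "\<And>s. s \<in> carrier R \<Longrightarrow> (\<And>a. a \<in> A \<Longrightarrow> a \<odot>\<^bsub>M\<^esub> (s \<odot>\<^bsub>M\<^esub> x) = \<zero>\<^bsub>M\<^esub>) \<Longrightarrow>
        s \<odot>\<^bsub>M\<^esub> y = r \<odot>\<^bsub>M\<^esub> (s \<odot>\<^bsub>M\<^esub> x)"
      using max_product_multiplication[OF _ xy A(1)] soc by blast
    from this(1) this(2)[of \<one>] show "\<exists>r\<in>carrier R. y = r \<odot>\<^bsub>M\<^esub> x"
      using xy A(2) by auto
  qed
qed (use annihilator_reflecting_imp_essential[OF noeth] annihilator_reflecting_imp_multiplicity_free in auto)

end


section \<open>Copies of modules in another type\<close>

text \<open>Trace modules and injectivity refer to modules with carriers in one fixed type; an injection into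
  that type carries a module over.\<close>

definition copy_module :: "('b \<Rightarrow> 'u) \<Rightarrow> ('a, 'b, 'm) module_scheme \<Rightarrow> ('a, 'u) module"
  where "copy_module \<phi> M =
    \<lparr>carrier = \<phi> ` carrier M, monoid.mult = undefined, one = undefined,
     ring.zero = \<phi> \<zero>\<^bsub>M\<^esub>, ring.add = (\<lambda>u v. \<phi> (inv_into UNIV \<phi> u \<oplus>\<^bsub>M\<^esub> inv_into UNIV \<phi> v)),
     smult = (\<lambda>a u. \<phi> (a \<odot>\<^bsub>M\<^esub> inv_into UNIV \<phi> u))\<rparr>"

lemma copy_module_simps:
  "carrier (copy_module \<phi> M) = \<phi> ` carrier M"
  "\<zero>\<^bsub>copy_module \<phi> M\<^esub> = \<phi> \<zero>\<^bsub>M\<^esub>"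
  "u \<oplus>\<^bsub>copy_module \<phi> M\<^esub> v = \<phi> (inv_into UNIV \<phi> u \<oplus>\<^bsub>M\<^esub> inv_into UNIV \<phi> v)"
  "a \<odot>\<^bsub>copy_module \<phi> M\<^esub> u = \<phi> (a \<odot>\<^bsub>M\<^esub> inv_into UNIV \<phi> u)"
  by (simp_all add: copy_module_def)

lemma copy_module_module:
  assumes M: "module R M" and inj: "inj \<phi>"
  shows "module R (copy_module \<phi> M)"
proof -
  interpret M: module R M by fact
  show ?thesis
  proof (rule moduleI[OF M.is_cring], rule abelian_groupI2)
    fix x assume "x \<in> carrier (copy_module \<phi> M)"
    then obtain y where y: "y \<in> carrier M" "x = \<phi> y" by (auto simp: copy_module_simps)
    show "\<exists>y\<in>carrier (copy_module \<phi> M). y \<oplus>\<^bsub>copy_module \<phi> M\<^esub> x = \<zero>\<^bsub>copy_module \<phi> M\<^esub>"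
      using y by (intro bexI[of _ "\<phi> (\<ominus>\<^bsub>M\<^esub> y)"]) (auto simp: copy_module_simps inj M.l_neg)
  qed (auto simp: copy_module_simps inj M.a_ac M.smult_l_distr M.smult_r_distr M.smult_assoc1)
qed

lemma mod_hom_from_copy:
  assumes inj: "inj \<phi>" and M: "module R M" and g: "g \<in> mod_hom R M N"
  shows "(\<lambda>u\<in>\<phi> ` carrier M. g (inv_into UNIV \<phi> u)) \<in> mod_hom R (copy_module \<phi> M) N"
proof -
  interpret M: module R M by fact
  show ?thesis
    using mod_homD[OF g] by (auto simp: mod_hom_def copy_module_simps inj)
qed

lemma mod_hom_via_copy:
  assumes inj: "inj \<phi>" and M: "module R M" and g: "g \<in> mod_hom R (copy_module \<phi> M) N"
  shows "(\<lambda>x\<in>carrier M. g (\<phi> x)) \<in> mod_hom R M N"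
proof -
  interpret M: module R M by fact
  have add: "\<phi> (x \<oplus>\<^bsub>M\<^esub> y) = \<phi> x \<oplus>\<^bsub>copy_module \<phi> M\<^esub> \<phi> y" for x y
    by (simp add: copy_module_simps inj)
  have smult: "\<phi> (a \<odot>\<^bsub>M\<^esub> x) = a \<odot>\<^bsub>copy_module \<phi> M\<^esub> \<phi> x" for a x
    by (simp add: copy_module_simps inj)
  show ?thesis
    using mod_homD(1-3)[OF g]
    by (auto simp: mod_hom_def add smult copy_module_simps(1))
qed

text \<open>The extension property is applied to the inclusion of the copy of \<open>H\<close> into the copy of \<open>M\<close>, so
  the universe of the injective module need only admit an injection from the carrier type of \<open>M\<close>.\<close>

lemma injective_module_extend:
  fixes M :: "('a, 'b, 'm) module_scheme" and \<phi> :: "'b \<Rightarrow> 'u"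
  assumes E: "injective_module TYPE('u) R E" and inj: "inj \<phi>"
    and M: "module R M" and H: "submodule H R M" and g: "g \<in> mod_hom R (M\<lparr>carrier := H\<rparr>) E"
  shows "\<exists>f\<in>mod_hom R M E. \<forall>x\<in>H. f x = g x"
proof -
  interpret M: module R M by fact
  let ?N = "M\<lparr>carrier := H\<rparr>"
  have N: "module R ?N" by (rule submodule.submodule_is_module[OF H M])
  have HM: "H \<subseteq> carrier M" by (rule M.submoduleE(1)[OF H])
  note sub = M.submoduleE[OF H]
  let ?i = "\<lambda>u\<in>\<phi> ` H. u"
  have i: "?i \<in> mod_hom R (copy_module \<phi> ?N) (copy_module \<phi> M)"
    using HM sub by (auto simp: mod_hom_def copy_module_simps inj)
  let ?g = "\<lambda>u\<in>\<phi> ` H. g (inv_into UNIV \<phi> u)"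
  have g': "?g \<in> mod_hom R (copy_module \<phi> ?N) E"
    using mod_hom_from_copy[OF inj N g] by simp
  have "inj_on ?i (carrier (copy_module \<phi> ?N))"
    by (auto simp: inj_on_def copy_module_simps)
  then obtain f where f: "f \<in> mod_hom R (copy_module \<phi> M) E"
    "\<forall>u\<in>carrier (copy_module \<phi> ?N). f (?i u) = ?g u"
    using E copy_module_module[OF N inj] copy_module_module[OF M inj] i g'
    unfolding injective_module_def by blast
  have "(\<lambda>x\<in>carrier M. f (\<phi> x)) \<in> mod_hom R M E"
    by (rule mod_hom_via_copy[OF inj M f(1)])
  moreover have "(\<lambda>x\<in>carrier M. f (\<phi> x)) x = g x" if "x \<in> H" for x
    using that f(2) HM by (auto simp: copy_module_simps inj)
  ultimately show ?thesis by blast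
qed


section \<open>Trace modules and annihilators\<close>

lemma (in module) cyclic_submodule_submodule:
  assumes "x \<in> carrier M"
  shows "submodule {a \<odot>\<^bsub>M\<^esub> x |a. a \<in> carrier R} R M"
proof (rule submoduleI)
  show "\<zero>\<^bsub>M\<^esub> \<in> {a \<odot>\<^bsub>M\<^esub> x |a. a \<in> carrier R}" using assms by (force intro: exI[of _ \<zero>])
  fix u v assume u: "u \<in> {a \<odot>\<^bsub>M\<^esub> x |a. a \<in> carrier R}" and v: "v \<in> {a \<odot>\<^bsub>M\<^esub> x |a. a \<in> carrier R}"
  then obtain a b where ab: "a \<in> carrier R" "u = a \<odot>\<^bsub>M\<^esub> x" "b \<in> carrier R" "v = b \<odot>\<^bsub>M\<^esub> x" by blast
  have "u \<oplus>\<^bsub>M\<^esub> v = (a \<oplus> b) \<odot>\<^bsub>M\<^esub> x" using ab assms by (simp add: smult_l_distr)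
  then show "u \<oplus>\<^bsub>M\<^esub> v \<in> {a \<odot>\<^bsub>M\<^esub> x |a. a \<in> carrier R}" using ab R.a_closed by blast
next
  fix u assume "u \<in> {a \<odot>\<^bsub>M\<^esub> x |a. a \<in> carrier R}"
  then obtain a where a: "a \<in> carrier R" "u = a \<odot>\<^bsub>M\<^esub> x" by blast
  have "\<ominus>\<^bsub>M\<^esub> u = (\<ominus> a) \<odot>\<^bsub>M\<^esub> x" using a assms by (simp add: smult_l_minus)
  then show "\<ominus>\<^bsub>M\<^esub> u \<in> {a \<odot>\<^bsub>M\<^esub> x |a. a \<in> carrier R}" using a R.a_inv_closed by blast
  fix b assume b: "b \<in> carrier R"
  have "b \<odot>\<^bsub>M\<^esub> u = (b \<otimes> a) \<odot>\<^bsub>M\<^esub> x" using a b assms by (simp add: smult_assoc1)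
  then show "b \<odot>\<^bsub>M\<^esub> u \<in> {a \<odot>\<^bsub>M\<^esub> x |a. a \<in> carrier R}" using a b R.m_closed by blast
qed (use assms in auto)

text \<open>The map \<open>a x \<mapsto> a y\<close> is well defined because \<open>a x = b x\<close> puts \<open>a - b\<close> into \<open>ann x \<subseteq> ann y\<close>.\<close>

lemma cyclic_hom_exists:
  assumes M: "module R M" and N: "module R N" and x: "x \<in> carrier M" and y: "y \<in> carrier N"
    and ann: "annihilator R M x \<subseteq> annihilator R N y"
  shows "\<exists>f\<in>mod_hom R (M\<lparr>carrier := {a \<odot>\<^bsub>M\<^esub> x |a. a \<in> carrier R}\<rparr>) N.
    \<forall>a\<in>carrier R. f (a \<odot>\<^bsub>M\<^esub> x) = a \<odot>\<^bsub>N\<^esub> y"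
proof -
  interpret M: module R M by fact
  interpret N: module R N by fact
  let ?C = "{a \<odot>\<^bsub>M\<^esub> x |a. a \<in> carrier R}"
  define f where "f = (\<lambda>u\<in>?C. (SOME a. a \<in> carrier R \<and> u = a \<odot>\<^bsub>M\<^esub> x) \<odot>\<^bsub>N\<^esub> y)"
  have f: "f (a \<odot>\<^bsub>M\<^esub> x) = a \<odot>\<^bsub>N\<^esub> y" if a: "a \<in> carrier R" for a
  proof -
    define b where "b = (SOME b. b \<in> carrier R \<and> a \<odot>\<^bsub>M\<^esub> x = b \<odot>\<^bsub>M\<^esub> x)"
    have b: "b \<in> carrier R" "a \<odot>\<^bsub>M\<^esub> x = b \<odot>\<^bsub>M\<^esub> x"
      using someI_ex[of "\<lambda>b. b \<in> carrier R \<and> a \<odot>\<^bsub>M\<^esub> x = b \<odot>\<^bsub>M\<^esub> x"] a unfolding b_def by blast+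
    have "b \<ominus>\<^bsub>R\<^esub> a \<in> annihilator R M x"
      using a b x by (simp add: annihilator_def M.smult_l_diff M.diff_eq_zero_iff)
    then have "(b \<ominus>\<^bsub>R\<^esub> a) \<odot>\<^bsub>N\<^esub> y = \<zero>\<^bsub>N\<^esub>" using ann by (auto simp: annihilator_def)
    then have "b \<odot>\<^bsub>N\<^esub> y = a \<odot>\<^bsub>N\<^esub> y" using a b y by (simp add: N.smult_l_diff N.diff_eq_zero_iff)
    moreover have "a \<odot>\<^bsub>M\<^esub> x \<in> ?C" using a by blast
    then have "f (a \<odot>\<^bsub>M\<^esub> x) = b \<odot>\<^bsub>N\<^esub> y" by (simp add: f_def b_def)
    ultimately show ?thesis by simp
  qed
  have "f \<in> mod_hom R (M\<lparr>carrier := ?C\<rparr>) N"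
    unfolding mod_hom_def
  proof (intro CollectI conjI ballI, simp_all)
    have "f \<in> extensional ?C" by (simp add: f_def)
    moreover have "f u \<in> carrier N" if "u \<in> ?C" for u using that f y by auto
    ultimately show "f \<in> ?C \<rightarrow>\<^sub>E carrier N" by (auto simp only: PiE_def)
  next
    fix u v assume "\<exists>a. u = a \<odot>\<^bsub>M\<^esub> x \<and> a \<in> carrier R" "\<exists>a. v = a \<odot>\<^bsub>M\<^esub> x \<and> a \<in> carrier R"
    then obtain a b where ab: "a \<in> carrier R" "u = a \<odot>\<^bsub>M\<^esub> x" "b \<in> carrier R" "v = b \<odot>\<^bsub>M\<^esub> x" by blast
    have "u \<oplus>\<^bsub>M\<^esub> v = (a \<oplus>\<^bsub>R\<^esub> b) \<odot>\<^bsub>M\<^esub> x" using ab x by (simp add: M.smult_l_distr)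
    then show "f (u \<oplus>\<^bsub>M\<^esub> v) = f u \<oplus>\<^bsub>N\<^esub> f v"
      using f[of "a \<oplus>\<^bsub>R\<^esub> b"] ab f y by (simp add: N.smult_l_distr)
  next
    fix b u assume b: "b \<in> carrier R" and "\<exists>a. u = a \<odot>\<^bsub>M\<^esub> x \<and> a \<in> carrier R"
    then obtain a where a: "a \<in> carrier R" "u = a \<odot>\<^bsub>M\<^esub> x" by blast
    have "b \<odot>\<^bsub>M\<^esub> u = (b \<otimes>\<^bsub>R\<^esub> a) \<odot>\<^bsub>M\<^esub> x" using a b x by (simp add: M.smult_assoc1)
    then show "f (b \<odot>\<^bsub>M\<^esub> u) = b \<odot>\<^bsub>N\<^esub> f u"
      using f[of "b \<otimes>\<^bsub>R\<^esub> a"] a b f y by (simp add: N.smult_assoc1)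
  qed
  with f show ?thesis by blast
qed

text \<open>The values of maps \<open>g: M \<rightarrow> V\<close> generate \<open>Y\<close>, and \<open>f \<circ> g\<close> is another such map, so the elements
  that \<open>f\<close> keeps in \<open>Y\<close> form a submodule containing all generators.\<close>

lemma trace_closed_under_hom:
  assumes M: "module R M" and V: "module R V" and Y: "Y = trace_in R V M"
    and f: "f \<in> mod_hom R (V\<lparr>carrier := Y\<rparr>) V" and y: "y \<in> Y"
  shows "f y \<in> Y"
proof -
  interpret M: module R M by fact
  interpret V: module R V by fact
  let ?E = "{g m |g m. g \<in> mod_hom R M V \<and> m \<in> carrier M}"
  have hull: "Y = (\<lambda>H. submodule H R V) hull ?E" using trace_in_eq_hull[OF M V] Y by simp
  have Ec: "?E \<subseteq> carrier V" by (auto simp: mod_homD)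
  have YV: "submodule Y R V" unfolding hull by (rule hull_submodule[OF V Ec])
  note subY = V.submoduleE[OF YV]
  have EY: "?E \<subseteq> Y" unfolding hull by (rule hull_subset)
  have fh: "\<And>u. u \<in> Y \<Longrightarrow> f u \<in> carrier V"
    "\<And>u v. u \<in> Y \<Longrightarrow> v \<in> Y \<Longrightarrow> f (u \<oplus>\<^bsub>V\<^esub> v) = f u \<oplus>\<^bsub>V\<^esub> f v"
    "\<And>a u. a \<in> carrier R \<Longrightarrow> u \<in> Y \<Longrightarrow> f (a \<odot>\<^bsub>V\<^esub> u) = a \<odot>\<^bsub>V\<^esub> f u"
    using mod_homD(1-3)[OF f] by auto
  have N: "module R (V\<lparr>carrier := Y\<rparr>)" by (rule submodule.submodule_is_module[OF YV V])
  have "submodule {u \<in> Y. f u \<in> Y} R V"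
  proof -
    have s: "submodule {u \<in> carrier (V\<lparr>carrier := Y\<rparr>). f u \<in> Y} R (V\<lparr>carrier := Y\<rparr>)"
      by (rule preimage_submodule[OF N V f YV])
    note s' = module.submoduleE[OF N s]
    have z: "f \<zero>\<^bsub>V\<^esub> = \<zero>\<^bsub>V\<^esub>" "\<zero>\<^bsub>V\<^esub> \<in> Y"
      using mod_hom_zero[OF N V f] submodule_zero_closed[OF YV] by auto
    have m: "\<ominus>\<^bsub>V\<^esub> u = (\<ominus>\<^bsub>R\<^esub> \<one>\<^bsub>R\<^esub>) \<odot>\<^bsub>V\<^esub> u" if "u \<in> Y" for u
      using that subY(1) by (auto simp: V.smult_l_minus)
    show ?thesis
      by (rule V.submoduleI) (use subY z fh in \<open>auto simp: m\<close>)
  qed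
  moreover have "?E \<subseteq> {u \<in> Y. f u \<in> Y}"
  proof clarify
    fix g k assume g: "g \<in> mod_hom R M V" and k: "k \<in> carrier M"
    have gY: "g z \<in> Y" if "z \<in> carrier M" for z using g that EY by blast
    have "(\<lambda>z\<in>carrier M. f (g z)) \<in> mod_hom R M V"
      using mod_homD[OF g] fh gY by (auto simp: mod_hom_def)
    then have "(\<lambda>z\<in>carrier M. f (g z)) k \<in> ?E" using k by blast
    then show "g k \<in> Y \<and> f (g k) \<in> Y" using EY gY[OF k] k by auto
  qed
  ultimately have "Y \<subseteq> {u \<in> Y. f u \<in> Y}" unfolding hull by (intro hull_minimal)
  then show ?thesis using y by blast
qed

text \<open>If \<open>ann x \<subseteq> ann y\<close>, the linear map \<open>R x \<rightarrow> V\<close> with \<open>x \<mapsto> y\<close> has to preserve the trace module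
  \<open>R x\<close>.\<close>

lemma cyclic_traces_imp_annihilator_reflecting:
  assumes V: "module R V" and tr: "\<And>Y. cyclic_submodule R V Y \<Longrightarrow> trace_module TYPE('u) R V Y"
  shows "annihilator_reflecting R V"
  unfolding annihilator_reflecting_def
proof (intro ballI impI)
  interpret V: module R V by fact
  fix x y assume x: "x \<in> carrier V" and y: "y \<in> carrier V"
    and ann: "annihilator R V x \<subseteq> annihilator R V y"
  let ?Y = "{a \<odot>\<^bsub>V\<^esub> x |a. a \<in> carrier R}"
  obtain f where f: "f \<in> mod_hom R (V\<lparr>carrier := ?Y\<rparr>) V" "\<And>a. a \<in> carrier R \<Longrightarrow> f (a \<odot>\<^bsub>V\<^esub> x) = a \<odot>\<^bsub>V\<^esub> y"
    using cyclic_hom_exists[OF V V x y ann] by blast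
  have "cyclic_submodule R V ?Y" using x by (auto simp: cyclic_submodule_def)
  from tr[OF this] obtain M :: "('a, 'u) module" where M: "module R M" "?Y = trace_in R V M"
    unfolding trace_module_def by blast
  have "x \<in> ?Y" using x by (force intro: exI[of _ "\<one>\<^bsub>R\<^esub>"])
  from trace_closed_under_hom[OF M(1) V M(2) f(1) this]
  have "f (\<one>\<^bsub>R\<^esub> \<odot>\<^bsub>V\<^esub> x) \<in> ?Y" using x by simp
  then have "y \<in> ?Y" using f(2)[of "\<one>\<^bsub>R\<^esub>"] y by simp
  then show "\<exists>r\<in>carrier R. y = r \<odot>\<^bsub>V\<^esub> x" by blast
qed

text \<open>\<open>Y\<close> is the trace of a copy of itself: the identity contributes all of \<open>Y\<close>, and any other linear
  map sends \<open>u \<in> Y\<close> to an element whose annihilator contains \<open>ann u\<close>, hence into \<open>R u \<subseteq> Y\<close>.\<close>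

lemma annihilator_reflecting_imp_trace:
  fixes V :: "('a, 'x, 'k) module_scheme" and \<phi> :: "'x \<Rightarrow> 'u"
  assumes V: "module R V" and inj: "inj \<phi>" and refl: "annihilator_reflecting R V"
    and Y: "submodule Y R V"
  shows "trace_module TYPE('u) R V Y"
proof -
  interpret V: module R V by fact
  let ?N = "V\<lparr>carrier := Y\<rparr>" let ?M = "copy_module \<phi> ?N"
  have N: "module R ?N" by (rule submodule.submodule_is_module[OF Y V])
  have M: "module R ?M" by (rule copy_module_module[OF N inj])
  note YV = V.submoduleE(1)[OF Y]
  let ?E = "{g m |g m. g \<in> mod_hom R ?M V \<and> m \<in> carrier ?M}"
  have "?E = Y"
  proof
    show "?E \<subseteq> Y"
    proof clarify
      fix g k assume g: "g \<in> mod_hom R ?M V" and k: "k \<in> carrier ?M"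
      then obtain u where u: "u \<in> Y" "k = \<phi> u" by (auto simp: copy_module_simps)
      have uc: "u \<in> carrier V" using u YV by blast
      let ?h = "\<lambda>x\<in>carrier ?N. g (\<phi> x)"
      have h: "?h \<in> mod_hom R ?N V" by (rule mod_hom_via_copy[OF inj N g])
      have "annihilator R V u \<subseteq> annihilator R V (?h u)"
      proof
        fix a assume a: "a \<in> annihilator R V u"
        then have "a \<odot>\<^bsub>V\<^esub> ?h u = ?h \<zero>\<^bsub>V\<^esub>"
          using mod_homD(3)[OF h, of a u] u(1) by (simp add: annihilator_def)
        also have "\<dots> = \<zero>\<^bsub>V\<^esub>" using mod_hom_zero[OF N V h] by simp
        finally show "a \<in> annihilator R V (?h u)" using a by (simp add: annihilator_def)
      qed
      moreover have "?h u \<in> carrier V" using mod_homD(1)[OF h] u by auto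
      ultimately obtain r where "r \<in> carrier R" "?h u = r \<odot>\<^bsub>V\<^esub> u"
        using refl uc unfolding annihilator_reflecting_def by blast
      then show "g k \<in> Y" using u V.submoduleE(4)[OF Y] by auto
    qed
    have id: "(\<lambda>x\<in>Y. x) \<in> mod_hom R ?N V"
      using YV V.submoduleE[OF Y] by (auto simp: mod_hom_def)
    show "Y \<subseteq> ?E"
    proof
      fix y assume y: "y \<in> Y"
      let ?g = "\<lambda>u\<in>\<phi> ` Y. (\<lambda>x\<in>Y. x) (inv_into UNIV \<phi> u)"
      have "?g \<in> mod_hom R ?M V" using mod_hom_from_copy[OF inj N id] by simp
      moreover have "\<phi> y \<in> carrier ?M" using y by (simp add: copy_module_simps)
      moreover have "y = ?g (\<phi> y)" using y by (simp add: inj)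
      ultimately show "y \<in> ?E" by blast
    qed
  qed
  then have "trace_in R V ?M = Y"
    using trace_in_eq_hull[OF M V] Y by (simp add: hull_same)
  then show ?thesis using M Y unfolding trace_module_def by blast
qed


section \<open>Envelopes of simple modules\<close>

text \<open>All that is used of an envelope besides injectivity. The image \<open>e\<close> of \<open>1 \<in> R / m\<close> has annihilator
  \<open>m\<close>. By essentiality, \<open>R w\<close> contains a nonzero multiple \<open>s e\<close>; as \<open>s \<notin> m\<close> is invertible modulo
  \<open>m\<close>, it contains \<open>e\<close> itself.\<close>

lemma envelope_generator:
  fixes R (structure)
  assumes m: "m \<in> Max_spec R" and R: "cring R"
    and E: "injective_envelope TYPE('u) R (quot_module (self_module R) m) E"
  shows "\<exists>e\<in>carrier E. annihilator R E e = m \<and>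
    (\<forall>w\<in>carrier E. w \<noteq> \<zero>\<^bsub>E\<^esub> \<longrightarrow> (\<exists>r\<in>carrier R. r \<odot>\<^bsub>E\<^esub> w = e))"
proof -
  let ?S = "self_module R" let ?Q = "quot_module ?S m"
  interpret cring R by fact
  interpret m: ideal m R by (rule Max_spec_ideal[OF m])
  have modE: "module R E" using E by (simp add: injective_envelope_def injective_module_def)
  interpret E: module R E by fact
  have modS: "module R ?S" by (rule self_module_module[OF R])
  interpret S: module R ?S by fact
  have S: "carrier ?S = carrier R" "\<zero>\<^bsub>?S\<^esub> = \<zero>" "\<And>a b. a \<oplus>\<^bsub>?S\<^esub> b = a \<oplus> b" "\<And>a b. a \<odot>\<^bsub>?S\<^esub> b = a \<otimes> b"
    by (simp_all add: self_module_def)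
  \<comment> \<open>The negation of a module is determined by the addition, so it agrees with that of the ring
    although the two records differ.\<close>
  have minus: "\<ominus>\<^bsub>?S\<^esub> a = \<ominus> a" if "a \<in> carrier R" for a
    using that by (intro S.minus_equality) (simp_all add: S l_neg)
  have sub: "submodule m R ?S"
    by (rule S.submoduleI) (auto simp: S minus m.I_l_closed)
  interpret H: abelian_subgroup m ?S by (rule submodule_abelian_subgroup[OF modS sub])
  have modQ: "module R ?Q" by (rule quot_module_module[OF modS sub])
  obtain j where j: "essential_mono R ?Q E j" using E by (auto simp: injective_envelope_def)
  then have jh: "j \<in> mod_hom R ?Q E" and inj: "inj_on j (carrier ?Q)"
    and ess: "\<And>H. submodule H R E \<Longrightarrow> H \<noteq> {\<zero>\<^bsub>E\<^esub>} \<Longrightarrow> H \<inter> j ` carrier ?Q \<noteq> {\<zero>\<^bsub>E\<^esub>}"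
    by (auto simp: essential_mono_def)
  let ?c = "\<lambda>r. m +>\<^bsub>?S\<^esub> r"
  have cQ: "?c r \<in> carrier ?Q" if "r \<in> carrier R" for r
    using that by (auto simp: quot_module_simps A_RCOSETS_def' S)
  have Qc: "\<exists>r\<in>carrier R. C = ?c r" if "C \<in> carrier ?Q" for C
    using that by (auto simp: quot_module_simps A_RCOSETS_def' S)
  define e where "e = j (?c \<one>)"
  have ec: "e \<in> carrier E" unfolding e_def by (rule mod_homD(1)[OF jh cQ]) simp
  have jc: "j (?c r) = r \<odot>\<^bsub>E\<^esub> e" if r: "r \<in> carrier R" for r
    using mod_homD(3)[OF jh r cQ[of \<one>]] quot_module_smult[OF modS sub r, of \<one>] r by (simp add: S e_def)
  have ann: "r \<odot>\<^bsub>E\<^esub> e = \<zero>\<^bsub>E\<^esub> \<longleftrightarrow> r \<in> m" if r: "r \<in> carrier R" for r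
  proof -
    have "j m = \<zero>\<^bsub>E\<^esub>" using mod_hom_zero[OF modQ modE jh] by (simp add: quot_module_simps)
    moreover have mQ: "m \<in> carrier ?Q"
      using module.axioms(2)[OF modQ] abelian_monoid.zero_closed abelian_group.axioms(1)
      by (metis quot_module_simps(2))
    ultimately have "r \<odot>\<^bsub>E\<^esub> e = \<zero>\<^bsub>E\<^esub> \<longleftrightarrow> ?c r = m"
      using inj_on_eq_iff[OF inj cQ[OF r] mQ] jc[OF r] by simp
    also have "\<dots> \<longleftrightarrow> r \<in> m"
      using H.a_rcos_self[of r] H.a_rcos_const[of r] r by (auto simp: S)
    finally show ?thesis .
  qed
  have "\<exists>r\<in>carrier R. r \<odot>\<^bsub>E\<^esub> w = e" if w: "w \<in> carrier E" "w \<noteq> \<zero>\<^bsub>E\<^esub>" for w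
  proof -
    let ?H = "{a \<odot>\<^bsub>E\<^esub> w |a. a \<in> carrier R}"
    have sH: "submodule ?H R E" by (rule E.cyclic_submodule_submodule[OF w(1)])
    have "w \<in> ?H" using w by (force intro: exI[of _ \<one>])
    with w have "?H \<noteq> {\<zero>\<^bsub>E\<^esub>}" by blast
    from ess[OF sH this] have "?H \<inter> j ` carrier ?Q \<noteq> {\<zero>\<^bsub>E\<^esub>}" .
    moreover have "\<zero>\<^bsub>E\<^esub> \<in> ?H \<inter> j ` carrier ?Q"
      using submodule_zero_closed[OF image_submodule[OF modQ modE jh]] submodule_zero_closed[OF sH]
      by blast
    ultimately obtain v where v: "v \<in> ?H" "v \<in> j ` carrier ?Q" "v \<noteq> \<zero>\<^bsub>E\<^esub>" by blast
    from v(1) obtain a where a: "a \<in> carrier R" "v = a \<odot>\<^bsub>E\<^esub> w" by blast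
    from v(2) obtain C where C: "C \<in> carrier ?Q" "v = j C" by blast
    then obtain s where s: "s \<in> carrier R" "v = s \<odot>\<^bsub>E\<^esub> e" using Qc[OF C(1)] jc by auto
    then have "s \<notin> m" using v(3) ann by blast
    then obtain t where t: "t \<in> carrier R" "t \<otimes> s \<ominus> \<one> \<in> m"
      using Max_spec_inverse[OF m s(1)] by blast
    have "(t \<otimes> s \<ominus> \<one>) \<odot>\<^bsub>E\<^esub> e = \<zero>\<^bsub>E\<^esub>" using t s ann by simp
    then have "t \<odot>\<^bsub>E\<^esub> v = e" using t s ec by (simp add: E.smult_l_diff E.diff_eq_zero_iff E.smult_assoc1)
    then have "(t \<otimes> a) \<odot>\<^bsub>E\<^esub> w = e" using a t w by (simp add: E.smult_assoc1)
    then show ?thesis using a t by blast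
  qed
  moreover have "annihilator R E e = m" using ann m.Icarr by (auto simp: annihilator_def)
  ultimately show ?thesis using ec by blast
qed

lemma mod_hom_inj_onI:
  assumes M: "module R M" and N: "module R N" and f: "f \<in> mod_hom R M N"
    and ker: "\<And>x. x \<in> carrier M \<Longrightarrow> x \<noteq> \<zero>\<^bsub>M\<^esub> \<Longrightarrow> f x \<noteq> \<zero>\<^bsub>N\<^esub>"
  shows "inj_on f (carrier M)"
proof (rule inj_onI)
  interpret M: module R M by fact
  interpret N: module R N by fact
  fix x y assume xy: "x \<in> carrier M" "y \<in> carrier M" "f x = f y"
  have "f (x \<ominus>\<^bsub>M\<^esub> y) = \<zero>\<^bsub>N\<^esub>"
    using mod_hom_minus[OF M N f xy(1,2)] xy mod_homD(1)[OF f] by (simp add: N.diff_eq_zero_iff)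
  then have "x \<ominus>\<^bsub>M\<^esub> y = \<zero>\<^bsub>M\<^esub>" using ker[of "x \<ominus>\<^bsub>M\<^esub> y"] xy by auto
  then show "x = y" using xy by (simp add: M.diff_eq_zero_iff)
qed

lemma mod_hom_max_torsion:
  assumes M: "module R M" and N: "module R N" and f: "f \<in> mod_hom R M N"
    and m: "m \<subseteq> carrier R" and x: "x \<in> max_torsion R M m"
  shows "f x \<in> max_torsion R N m"
proof -
  have "a \<odot>\<^bsub>N\<^esub> f x = \<zero>\<^bsub>N\<^esub>" if "a \<in> m" for a
    using mod_homD(3)[OF f, of a x] that m x mod_hom_zero[OF M N f] by (auto simp: max_torsion_def)
  then show ?thesis using x mod_homD(1)[OF f] by (auto simp: max_torsion_def)
qed

text \<open>A family of modules in which \<open>e m\<close> spans a copy of \<open>R / m\<close> that is essential in \<open>E m\<close>.\<close>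

locale simple_envelopes = cring R for R (structure) +
  fixes E :: "'a set \<Rightarrow> ('a, 'e, 'l) module_scheme" and e :: "'a set \<Rightarrow> 'e"
  assumes E_module: "m \<in> Max_spec R \<Longrightarrow> module R (E m)"
    and gen_closed: "m \<in> Max_spec R \<Longrightarrow> e m \<in> carrier (E m)"
    and gen_annihilator: "m \<in> Max_spec R \<Longrightarrow> annihilator R (E m) (e m) = m"
    and gen_essential: "m \<in> Max_spec R \<Longrightarrow> w \<in> carrier (E m) \<Longrightarrow> w \<noteq> \<zero>\<^bsub>E m\<^esub> \<Longrightarrow>
      \<exists>r\<in>carrier R. r \<odot>\<^bsub>E m\<^esub> w = e m"
begin

abbreviation "envelope_sum \<equiv> direct_sum (Max_spec R) E"

lemma gen_nonzero:
  assumes m: "m \<in> Max_spec R" shows "e m \<noteq> \<zero>\<^bsub>E m\<^esub>"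
proof
  assume "e m = \<zero>\<^bsub>E m\<^esub>"
  then have "\<one> \<in> annihilator R (E m) (e m)"
    using module.smult_r_null[OF E_module[OF m] one_closed] by (simp add: annihilator_def)
  then show False using gen_annihilator[OF m] Max_spec_one_notin[OF m] by simp
qed

lemma gen_torsion:
  assumes m: "m \<in> Max_spec R" shows "e m \<in> max_torsion R (E m) m"
proof -
  have "a \<odot>\<^bsub>E m\<^esub> e m = \<zero>\<^bsub>E m\<^esub>" if "a \<in> annihilator R (E m) (e m)" for a
    using that by (simp add: annihilator_def)
  then show ?thesis using gen_annihilator[OF m] gen_closed[OF m] by (simp add: max_torsion_def)
qed

lemma envelope_sum_module: "module R envelope_sum"
  by (rule direct_sum_module[OF is_cring E_module])

text \<open>A nonzero \<open>w\<close> would have the multiple \<open>e n\<close>, whose annihilator \<open>n\<close> would then contain \<open>m\<close>.\<close>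

lemma torsion_other_zero:
  assumes m: "m \<in> Max_spec R" and n: "n \<in> Max_spec R" and mn: "n \<noteq> m"
    and w: "w \<in> max_torsion R (E n) m"
  shows "w = \<zero>\<^bsub>E n\<^esub>"
proof (rule ccontr)
  interpret En: module R "E n" by (rule E_module[OF n])
  assume "w \<noteq> \<zero>\<^bsub>E n\<^esub>"
  moreover have wc: "w \<in> carrier (E n)" using w by (simp add: max_torsion_def)
  ultimately obtain r where r: "r \<in> carrier R" "r \<odot>\<^bsub>E n\<^esub> w = e n" using gen_essential[OF n] by blast
  have "m \<subseteq> annihilator R (E n) (e n)"
  proof
    fix a assume a: "a \<in> m"
    then have "a \<odot>\<^bsub>E n\<^esub> e n = \<zero>\<^bsub>E n\<^esub>"
      using En.max_torsionD(2)[OF w a] r wc Max_spec_subset[OF m a] En.smult_left_commute[of a r w] by simp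
    then show "a \<in> annihilator R (E n) (e n)" using Max_spec_subset[OF m a] by (simp add: annihilator_def)
  qed
  then show False using gen_annihilator[OF n] Max_spec_eqI[OF m n] mn by simp
qed

text \<open>Both \<open>v\<close> and \<open>w\<close> have \<open>e m\<close> as a multiple, and the scalar taking \<open>v\<close> to \<open>e m\<close> can be inverted
  modulo \<open>m\<close>.\<close>

lemma torsion_span:
  assumes m: "m \<in> Max_spec R" and w: "w \<in> max_torsion R (E m) m" and v: "v \<in> max_torsion R (E m) m"
    and w0: "w \<noteq> \<zero>\<^bsub>E m\<^esub>"
  shows "\<exists>t\<in>carrier R. v = t \<odot>\<^bsub>E m\<^esub> w"
proof (cases "v = \<zero>\<^bsub>E m\<^esub>")
  interpret Em: module R "E m" by (rule E_module[OF m])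
  have wc: "w \<in> carrier (E m)" and vc: "v \<in> carrier (E m)" using w v by (auto simp: max_torsion_def)
  {
    case True
    then show ?thesis using wc by (intro bexI[of _ \<zero>]) auto
  next
    case False
    then obtain s where s: "s \<in> carrier R" "s \<odot>\<^bsub>E m\<^esub> v = e m" using gen_essential[OF m vc] by blast
    obtain r where r: "r \<in> carrier R" "r \<odot>\<^bsub>E m\<^esub> w = e m" using gen_essential[OF m wc w0] by blast
    have "s \<notin> m" using s(2) gen_nonzero[OF m] Em.max_torsionD(2)[OF v] by metis
    then obtain t where t: "t \<in> carrier R" "t \<otimes> s \<ominus> \<one> \<in> m" using Max_spec_inverse[OF m s(1)] by blast
    have "(t \<otimes> s \<ominus> \<one>) \<odot>\<^bsub>E m\<^esub> v = \<zero>\<^bsub>E m\<^esub>" using Em.max_torsionD(2)[OF v t(2)] .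
    then have "t \<odot>\<^bsub>E m\<^esub> e m = v"
      using t(1) s vc gen_closed[OF m] by (simp add: Em.smult_l_diff Em.diff_eq_zero_iff Em.smult_assoc1)
    then have "v = (t \<otimes> r) \<odot>\<^bsub>E m\<^esub> w" using r t(1) wc by (simp add: Em.smult_assoc1)
    then show ?thesis using r t(1) by blast
  }
qed

lemma envelope_sum_component:
  assumes "x \<in> carrier envelope_sum" "m \<in> Max_spec R"
  shows "x m \<in> carrier (E m)"
  using assms by (auto simp: direct_sum_simps)

lemma envelope_sum_eqI:
  assumes "x \<in> carrier envelope_sum" "y \<in> carrier envelope_sum" "\<And>m. m \<in> Max_spec R \<Longrightarrow> x m = y m"
  shows "x = y"
  using assms by (intro extensionalityI[of _ "Max_spec R"]) (auto simp: direct_sum_simps PiE_def)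

text \<open>Of an element of \<open>V[m]\<close> only the component in \<open>E m\<close> is nonzero, and \<open>(E m)[m]\<close> is
  one-dimensional.\<close>

lemma embeds_imp_multiplicity_free:
  assumes V: "module R V" and h: "h \<in> mod_hom R V envelope_sum" and inj: "inj_on h (carrier V)"
  shows "multiplicity_free_socle R V"
  unfolding multiplicity_free_socle_def
proof (intro ballI impI)
  interpret V: module R V by fact
  interpret S: module R envelope_sum by (rule envelope_sum_module)
  fix m x y assume m: "m \<in> Max_spec R" and x: "x \<in> max_torsion R V m" and y: "y \<in> max_torsion R V m"
    and x0: "x \<noteq> \<zero>\<^bsub>V\<^esub>"
  note xc = V.max_torsionD(1)[OF x] and yc = V.max_torsionD(1)[OF y]
  have tors: "h z n \<in> max_torsion R (E n) m" if "n \<in> Max_spec R" "z \<in> max_torsion R V m" for n z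
  proof -
    have hz: "h z \<in> max_torsion R envelope_sum m"
      using mod_hom_max_torsion[OF V envelope_sum_module h _ that(2)] Max_spec_subset[OF m] by blast
    have "a \<odot>\<^bsub>E n\<^esub> h z n = \<zero>\<^bsub>E n\<^esub>" if "a \<in> m" for a
      using fun_cong[OF S.max_torsionD(2)[OF hz that], of n] \<open>n \<in> Max_spec R\<close> by (simp add: direct_sum_simps)
    then show ?thesis
      using envelope_sum_component[OF S.max_torsionD(1)[OF hz] that(1)] by (simp add: max_torsion_def)
  qed
  have other: "h z n = \<zero>\<^bsub>E n\<^esub>" if "n \<in> Max_spec R" "n \<noteq> m" "z \<in> max_torsion R V m" for n z
    using torsion_other_zero[OF m that(1,2) tors[OF that(1,3)]] .
  have hc: "h x \<in> carrier envelope_sum" "h y \<in> carrier envelope_sum" using mod_homD(1)[OF h] xc yc by auto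
  have "h x m \<noteq> \<zero>\<^bsub>E m\<^esub>"
  proof
    assume "h x m = \<zero>\<^bsub>E m\<^esub>"
    then have "h x = \<zero>\<^bsub>envelope_sum\<^esub>"
      by (intro envelope_sum_eqI[OF hc(1) S.zero_closed]) (use other[OF _ _ x] in \<open>auto simp: direct_sum_simps(2)\<close>)
    then have "h x = h \<zero>\<^bsub>V\<^esub>" using mod_hom_zero[OF V envelope_sum_module h] by simp
    then show False using inj xc x0 by (auto dest: inj_onD)
  qed
  then obtain t where t: "t \<in> carrier R" "h y m = t \<odot>\<^bsub>E m\<^esub> h x m"
    using torsion_span[OF m tors[OF m x] tors[OF m y]] by blast
  have "h y = t \<odot>\<^bsub>envelope_sum\<^esub> h x"
  proof (rule envelope_sum_eqI)
    fix n assume n: "n \<in> Max_spec R"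
    interpret En: module R "E n" by (rule E_module[OF n])
    show "h y n = (t \<odot>\<^bsub>envelope_sum\<^esub> h x) n"
      using t n other[OF n _ x] other[OF n _ y] by (cases "n = m") (auto simp: direct_sum_simps)
  qed (use hc t in auto)
  also have "\<dots> = h (t \<odot>\<^bsub>V\<^esub> x)" using mod_homD(3)[OF h t(1) xc] by simp
  finally have "y = t \<odot>\<^bsub>V\<^esub> x" using inj xc yc t(1) by (auto dest: inj_onD)
  then show "\<exists>r\<in>carrier R. y = r \<odot>\<^bsub>V\<^esub> x" using t(1) by blast
qed

text \<open>Induction on the size of the support. Some multiple \<open>s x\<close> has \<open>m\<close>-component \<open>e m\<close>. Multiplying
  it by an element of \<open>m\<close> kills that component and so shrinks the support; hence either \<open>m\<close> kills
  \<open>s x\<close>, or the induction hypothesis applies to one of these multiples.\<close>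

lemma embeds_imp_essential:
  assumes V: "module R V" and h: "h \<in> mod_hom R V envelope_sum" and inj: "inj_on h (carrier V)"
  shows "essential_socle R V"
  unfolding essential_socle_def
proof (intro ballI impI)
  interpret V: module R V by fact
  interpret S: module R envelope_sum by (rule envelope_sum_module)
  define supp where "supp z = {m \<in> Max_spec R. h z m \<noteq> \<zero>\<^bsub>E m\<^esub>}" for z
  have hc: "h z \<in> carrier envelope_sum" if "z \<in> carrier V" for z using mod_homD(1)[OF h that] .
  have fin: "finite (supp z)" if "z \<in> carrier V" for z
    using hc[OF that] by (simp add: supp_def direct_sum_simps)
  have supp0: "z = \<zero>\<^bsub>V\<^esub>" if z: "z \<in> carrier V" "supp z = {}" for z
  proof -
    have "h z = \<zero>\<^bsub>envelope_sum\<^esub>"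
      by (rule envelope_sum_eqI[OF hc[OF z(1)] S.zero_closed]) (use z(2) in \<open>auto simp: supp_def direct_sum_simps(2)\<close>)
    then have "h z = h \<zero>\<^bsub>V\<^esub>" using mod_hom_zero[OF V envelope_sum_module h] by simp
    then show ?thesis using inj z by (auto dest: inj_onD)
  qed
  have comp: "h (a \<odot>\<^bsub>V\<^esub> z) m = a \<odot>\<^bsub>E m\<^esub> h z m"
    if "a \<in> carrier R" "z \<in> carrier V" "m \<in> Max_spec R" for a z m
    using mod_homD(3)[OF h that(1,2)] that(3) by (simp add: direct_sum_simps)
  have suppm: "supp (a \<odot>\<^bsub>V\<^esub> z) \<subseteq> supp z" if "a \<in> carrier R" "z \<in> carrier V" for a z
    using comp[OF that] module.smult_r_null[OF E_module that(1)] by (auto simp: supp_def)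
  fix x assume "x \<in> carrier V" "x \<noteq> \<zero>\<^bsub>V\<^esub>"
  then show "\<exists>m\<in>Max_spec R. \<exists>r\<in>carrier R. r \<odot>\<^bsub>V\<^esub> x \<in> max_torsion R V m \<and> r \<odot>\<^bsub>V\<^esub> x \<noteq> \<zero>\<^bsub>V\<^esub>"
  proof (induction "card (supp x)" arbitrary: x rule: less_induct)
    case less
    then obtain m where m: "m \<in> Max_spec R" "h x m \<noteq> \<zero>\<^bsub>E m\<^esub>" using supp0[of x] by (auto simp: supp_def)
    interpret Em: module R "E m" by (rule E_module[OF m(1)])
    obtain s where s: "s \<in> carrier R" "s \<odot>\<^bsub>E m\<^esub> h x m = e m"
      using gen_essential[OF m(1) envelope_sum_component[OF hc[OF less(2)] m(1)] m(2)] by blast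
    have sxc: "s \<odot>\<^bsub>V\<^esub> x \<in> carrier V" using s less by simp
    have sxm: "h (s \<odot>\<^bsub>V\<^esub> x) m = e m" using comp[OF s(1) less(2) m(1)] s(2) by simp
    then have sx0: "s \<odot>\<^bsub>V\<^esub> x \<noteq> \<zero>\<^bsub>V\<^esub>"
      using gen_nonzero[OF m(1)] mod_hom_zero[OF V envelope_sum_module h] m(1) by (auto simp: direct_sum_simps)
    show ?case
    proof (cases "\<exists>a\<in>m. a \<odot>\<^bsub>V\<^esub> (s \<odot>\<^bsub>V\<^esub> x) \<noteq> \<zero>\<^bsub>V\<^esub>")
      case False
      then have "s \<odot>\<^bsub>V\<^esub> x \<in> max_torsion R V m" using sxc by (simp add: max_torsion_def)
      then show ?thesis using sx0 s m by blast
    next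
      case True
      then obtain a where a: "a \<in> m" "a \<odot>\<^bsub>V\<^esub> (s \<odot>\<^bsub>V\<^esub> x) \<noteq> \<zero>\<^bsub>V\<^esub>" by blast
      have ac: "a \<in> carrier R" by (rule Max_spec_subset[OF m(1) a(1)])
      have "h (a \<odot>\<^bsub>V\<^esub> (s \<odot>\<^bsub>V\<^esub> x)) m = \<zero>\<^bsub>E m\<^esub>"
        using comp[OF ac sxc m(1)] sxm Em.max_torsionD(2)[OF gen_torsion[OF m(1)] a(1)] by simp
      then have "m \<notin> supp (a \<odot>\<^bsub>V\<^esub> (s \<odot>\<^bsub>V\<^esub> x))" by (simp add: supp_def)
      moreover have "m \<in> supp x" using m by (simp add: supp_def)
      moreover have "supp (a \<odot>\<^bsub>V\<^esub> (s \<odot>\<^bsub>V\<^esub> x)) \<subseteq> supp x"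
        using suppm[OF ac sxc] suppm[OF s(1) less(2)] by blast
      ultimately have "card (supp (a \<odot>\<^bsub>V\<^esub> (s \<odot>\<^bsub>V\<^esub> x))) < card (supp x)"
        by (intro psubset_card_mono fin less(2)) blast
      from less(1)[OF this _ a(2)] obtain n r where nr: "n \<in> Max_spec R" "r \<in> carrier R"
        "r \<odot>\<^bsub>V\<^esub> (a \<odot>\<^bsub>V\<^esub> (s \<odot>\<^bsub>V\<^esub> x)) \<in> max_torsion R V n" "r \<odot>\<^bsub>V\<^esub> (a \<odot>\<^bsub>V\<^esub> (s \<odot>\<^bsub>V\<^esub> x)) \<noteq> \<zero>\<^bsub>V\<^esub>"
        using ac sxc by auto
      then show ?thesis
        using ac s(1) less(2) by (intro bexI[of _ n] bexI[of _ "r \<otimes> (a \<otimes> s)"]) (simp_all add: V.smult_assoc1)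
    qed
  qed
qed

text \<open>If \<open>f n\<close> vanishes on \<open>g z\<close> for all generators \<open>g\<close> of \<open>m\<close>, then \<open>m\<close> kills \<open>f n z\<close>, which is
  therefore zero unless \<open>n = m\<close>. So the support of \<open>z\<close> exceeds the union of finitely many finite
  supports by at most one element.\<close>

lemma hom_finite_support:
  assumes noeth: "noetherian_ring R" and V: "module R V" and ess: "essential_socle R V"
    and f: "\<And>m. m \<in> Max_spec R \<Longrightarrow> f m \<in> mod_hom R V (E m)" and x: "x \<in> carrier V"
  shows "finite {m \<in> Max_spec R. f m x \<noteq> \<zero>\<^bsub>E m\<^esub>}"
proof -
  interpret V: module R V by fact
  show ?thesis
  proof (rule V.socle_induct[OF noeth ess x])
    show "finite {m \<in> Max_spec R. f m \<zero>\<^bsub>V\<^esub> \<noteq> \<zero>\<^bsub>E m\<^esub>}"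
      using mod_hom_zero[OF V E_module f] by (auto intro: finite_subset[of _ "{}"])
  next
    fix z m assume z: "z \<in> carrier V" and m: "m \<in> Max_spec R"
      and IH: "\<And>a. a \<in> m \<Longrightarrow> finite {n \<in> Max_spec R. f n (a \<odot>\<^bsub>V\<^esub> z) \<noteq> \<zero>\<^bsub>E n\<^esub>}"
    obtain G where G: "G \<subseteq> carrier R" "finite G" "m = Idl G"
      using noetherian_ring.finetely_gen[OF noeth Max_spec_ideal[OF m]] by blast
    let ?F = "insert m (\<Union>g\<in>G. {n \<in> Max_spec R. f n (g \<odot>\<^bsub>V\<^esub> z) \<noteq> \<zero>\<^bsub>E n\<^esub>})"
    have "finite ?F" using G IH genideal_self by (metis (no_types, lifting) finite_UN_I finite_insert subsetD)
    moreover have "f n z = \<zero>\<^bsub>E n\<^esub>" if n: "n \<in> Max_spec R" "n \<notin> ?F" for n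
    proof (rule torsion_other_zero[OF m n(1)])
      interpret En: module R "E n" by (rule E_module[OF n(1)])
      show "n \<noteq> m" using n by auto
      have fz: "f n z \<in> carrier (E n)" by (rule mod_homD(1)[OF f[OF n(1)] z])
      have "g \<odot>\<^bsub>E n\<^esub> f n z = \<zero>\<^bsub>E n\<^esub>" if "g \<in> G" for g
        using that n G(1) mod_homD(3)[OF f[OF n(1)] _ z, of g] by auto
      then show "f n z \<in> max_torsion R (E n) m"
        using En.killed_by_genideal[OF G(1) fz] fz G(3) by (simp add: max_torsion_def)
    qed
    then have "{n \<in> Max_spec R. f n z \<noteq> \<zero>\<^bsub>E n\<^esub>} \<subseteq> ?F" by blast
    ultimately show "finite {n \<in> Max_spec R. f n z \<noteq> \<zero>\<^bsub>E n\<^esub>}" by (rule finite_subset[rotated])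
  qed
qed

text \<open>If \<open>V[m]\<close> is nonzero, it is \<open>R x\<close> with \<open>ann x = m = ann (e m)\<close>, and \<open>x \<mapsto> e m\<close> is the map.\<close>

lemma max_torsion_embeds:
  assumes V: "module R V" and free: "multiplicity_free_socle R V" and m: "m \<in> Max_spec R"
  shows "\<exists>g\<in>mod_hom R (V\<lparr>carrier := max_torsion R V m\<rparr>) (E m).
    \<forall>x\<in>max_torsion R V m. x \<noteq> \<zero>\<^bsub>V\<^esub> \<longrightarrow> g x \<noteq> \<zero>\<^bsub>E m\<^esub>"
proof -
  interpret V: module R V by fact
  interpret Em: module R "E m" by (rule E_module[OF m])
  let ?T = "max_torsion R V m"
  have msub: "m \<subseteq> carrier R" using Max_spec_subset[OF m] by blast
  have T: "submodule ?T R V" by (rule V.max_torsion_submodule[OF msub])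
  have zT: "\<zero>\<^bsub>V\<^esub> \<in> ?T"
    using msub by (auto simp: max_torsion_def)
  show ?thesis
  proof (cases "?T = {\<zero>\<^bsub>V\<^esub>}")
    case True
    have "(\<lambda>x\<in>?T. \<zero>\<^bsub>E m\<^esub>) \<in> mod_hom R (V\<lparr>carrier := ?T\<rparr>) (E m)"
      using True by (auto simp: mod_hom_def)
    then show ?thesis using True by blast
  next
    case False
    then obtain x where x: "x \<in> ?T" "x \<noteq> \<zero>\<^bsub>V\<^esub>" using zT by blast
    note xc = V.max_torsionD(1)[OF x(1)]
    have T_eq: "?T = {a \<odot>\<^bsub>V\<^esub> x |a. a \<in> carrier R}"
    proof
      show "?T \<subseteq> {a \<odot>\<^bsub>V\<^esub> x |a. a \<in> carrier R}" using free m x unfolding multiplicity_free_socle_def by blast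
      show "{a \<odot>\<^bsub>V\<^esub> x |a. a \<in> carrier R} \<subseteq> ?T" using V.submoduleE(4)[OF T] x(1) by blast
    qed
    have ann: "annihilator R V x = m" by (rule V.max_torsion_annihilator[OF m x])
    obtain g where g: "g \<in> mod_hom R (V\<lparr>carrier := ?T\<rparr>) (E m)"
      "\<And>a. a \<in> carrier R \<Longrightarrow> g (a \<odot>\<^bsub>V\<^esub> x) = a \<odot>\<^bsub>E m\<^esub> e m"
      using cyclic_hom_exists[OF V E_module[OF m] xc gen_closed[OF m]] gen_annihilator[OF m] ann
      unfolding T_eq by auto
    have "g y \<noteq> \<zero>\<^bsub>E m\<^esub>" if y: "y \<in> ?T" "y \<noteq> \<zero>\<^bsub>V\<^esub>" for y
    proof
      assume g0: "g y = \<zero>\<^bsub>E m\<^esub>"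
      obtain a where a: "a \<in> carrier R" "y = a \<odot>\<^bsub>V\<^esub> x"
        using y(1) unfolding T_eq by blast
      then have "a \<in> annihilator R (E m) (e m)" using g0 g(2)[OF a(1)] by (simp add: annihilator_def)
      then have "a \<in> m" using gen_annihilator[OF m] by simp
      then show False using y a V.max_torsionD(2)[OF x(1)] by blast
    qed
    then show ?thesis using g(1) by blast
  qed
qed

text \<open>The extensions \<open>f m\<close> of the embeddings of \<open>V[m]\<close> are arbitrary; the combined map has trivial
  kernel because a nonzero kernel element would have a nonzero multiple in some \<open>V[m]\<close>, on which
  \<open>f m\<close> is injective.\<close>

lemma socle_imp_embeds:
  fixes V :: "('a, 'x, 'k) module_scheme" and \<phi> :: "'x \<Rightarrow> 'u"
  assumes noeth: "noetherian_ring R" and V: "module R V" and inj: "inj \<phi>"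
    and E_inj: "\<And>m. m \<in> Max_spec R \<Longrightarrow> injective_module TYPE('u) R (E m)"
    and ess: "essential_socle R V" and free: "multiplicity_free_socle R V"
  shows "\<exists>h\<in>mod_hom R V envelope_sum. inj_on h (carrier V)"
proof -
  interpret V: module R V by fact
  interpret S: module R envelope_sum by (rule envelope_sum_module)
  have "\<exists>f\<in>mod_hom R V (E m). \<forall>x\<in>max_torsion R V m. x \<noteq> \<zero>\<^bsub>V\<^esub> \<longrightarrow> f x \<noteq> \<zero>\<^bsub>E m\<^esub>"
    if m: "m \<in> Max_spec R" for m
  proof -
    have T: "submodule (max_torsion R V m) R V"
      using Max_spec_subset[OF m] by (intro V.max_torsion_submodule) blast
    obtain g where g: "g \<in> mod_hom R (V\<lparr>carrier := max_torsion R V m\<rparr>) (E m)"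
      "\<forall>x\<in>max_torsion R V m. x \<noteq> \<zero>\<^bsub>V\<^esub> \<longrightarrow> g x \<noteq> \<zero>\<^bsub>E m\<^esub>"
      using max_torsion_embeds[OF V free m] by blast
    then show ?thesis
      using injective_module_extend[OF E_inj[OF m] inj V T g(1)] by metis
  qed
  then obtain f where f: "\<And>m. m \<in> Max_spec R \<Longrightarrow> f m \<in> mod_hom R V (E m)"
    "\<And>m x. m \<in> Max_spec R \<Longrightarrow> x \<in> max_torsion R V m \<Longrightarrow> x \<noteq> \<zero>\<^bsub>V\<^esub> \<Longrightarrow> f m x \<noteq> \<zero>\<^bsub>E m\<^esub>"
    by metis
  define h where "h = (\<lambda>x\<in>carrier V. \<lambda>m\<in>Max_spec R. f m x)"
  have hc: "h x \<in> carrier envelope_sum" if "x \<in> carrier V" for x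
  proof -
    have "{m \<in> Max_spec R. h x m \<noteq> \<zero>\<^bsub>E m\<^esub>} = {m \<in> Max_spec R. f m x \<noteq> \<zero>\<^bsub>E m\<^esub>}"
      using that by (auto simp: h_def)
    then show ?thesis
      using that hom_finite_support[OF noeth V ess f(1) that] mod_homD(1)[OF f(1)]
      by (auto simp: direct_sum_simps h_def)
  qed
  have h: "h \<in> mod_hom R V envelope_sum"
    unfolding mod_hom_def
  proof (intro CollectI conjI ballI)
    show "h \<in> carrier V \<rightarrow>\<^sub>E carrier envelope_sum" using hc by (auto simp: h_def)
  next
    fix x y assume "x \<in> carrier V" "y \<in> carrier V"
    then show "h (x \<oplus>\<^bsub>V\<^esub> y) = h x \<oplus>\<^bsub>envelope_sum\<^esub> h y"
      using mod_homD(2)[OF f(1)] by (auto simp: h_def direct_sum_simps intro!: restrict_ext)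
  next
    fix a x assume "a \<in> carrier R" "x \<in> carrier V"
    then show "h (a \<odot>\<^bsub>V\<^esub> x) = a \<odot>\<^bsub>envelope_sum\<^esub> h x"
      using mod_homD(3)[OF f(1)] by (auto simp: h_def direct_sum_simps intro!: restrict_ext)
  qed
  have "h x \<noteq> \<zero>\<^bsub>envelope_sum\<^esub>" if x: "x \<in> carrier V" "x \<noteq> \<zero>\<^bsub>V\<^esub>" for x
  proof
    assume h0: "h x = \<zero>\<^bsub>envelope_sum\<^esub>"
    obtain m r where mr: "m \<in> Max_spec R" "r \<in> carrier R" "r \<odot>\<^bsub>V\<^esub> x \<in> max_torsion R V m" "r \<odot>\<^bsub>V\<^esub> x \<noteq> \<zero>\<^bsub>V\<^esub>"
      using ess x unfolding essential_socle_def by blast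
    interpret Em: module R "E m" by (rule E_module[OF mr(1)])
    have "f m x = \<zero>\<^bsub>E m\<^esub>" using fun_cong[OF h0, of m] mr(1) x(1) by (simp add: h_def direct_sum_simps)
    then have "f m (r \<odot>\<^bsub>V\<^esub> x) = \<zero>\<^bsub>E m\<^esub>" using mod_homD(3)[OF f(1)[OF mr(1)] mr(2) x(1)] mr(2) by simp
    then show False using f(2)[OF mr(1,3,4)] by simp
  qed
  then have "inj_on h (carrier V)" by (intro mod_hom_inj_onI[OF V envelope_sum_module h])
  then show ?thesis using h by blast
qed

end


section \<open>The characterization\<close>

theorem theorem1p1:
  fixes R :: "('a, 'r) ring_scheme"
    and V :: "('a, 'x, 'k) module_scheme"
    and E :: "'a set \<Rightarrow> ('a, 'e, 'l) module_scheme"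
  assumes "cring R" and "noetherian_ring R" and "module R V"
    and "\<And>m. m \<in> Max_spec R \<Longrightarrow>
      injective_envelope TYPE('a + 'x + 'u) R (quot_module (self_module R) m) (E m)"
  shows "((\<forall>Y. submodule Y R V \<longrightarrow> trace_module TYPE('a + 'x + 'u) R V Y)
        \<longleftrightarrow> (\<forall>Y. cyclic_submodule R V Y \<longrightarrow> trace_module TYPE('a + 'x + 'u) R V Y)) \<and>
    ((\<forall>Y. cyclic_submodule R V Y \<longrightarrow> trace_module TYPE('a + 'x + 'u) R V Y)
        \<longleftrightarrow> (\<exists>h\<in>mod_hom R V (direct_sum (Max_spec R) E). inj_on h (carrier V)))"
proof -
  interpret V: module R V by fact
  define \<phi> :: "'x \<Rightarrow> 'a + 'x + 'u" where "\<phi> = (\<lambda>x. Inr (Inl x))"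
  have inj: "inj \<phi>" by (auto simp: \<phi>_def inj_def)
  have E_inj: "injective_module TYPE('a + 'x + 'u) R (E m)" if "m \<in> Max_spec R" for m
    using assms(4)[OF that] by (simp add: injective_envelope_def)
  obtain e where e: "\<And>m. m \<in> Max_spec R \<Longrightarrow> e m \<in> carrier (E m)"
    "\<And>m. m \<in> Max_spec R \<Longrightarrow> annihilator R (E m) (e m) = m"
    "\<And>m w. m \<in> Max_spec R \<Longrightarrow> w \<in> carrier (E m) \<Longrightarrow> w \<noteq> \<zero>\<^bsub>E m\<^esub> \<Longrightarrow> \<exists>r\<in>carrier R. r \<odot>\<^bsub>E m\<^esub> w = e m"
    using envelope_generator[OF _ assms(1) assms(4)] by metis
  have E_mod: "module R (E m)" if "m \<in> Max_spec R" for m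
    using E_inj[OF that] by (simp add: injective_module_def)
  interpret env: simple_envelopes R E e
    by (intro simple_envelopes.intro simple_envelopes_axioms.intro assms(1) E_mod e)
  let ?all = "\<forall>Y. submodule Y R V \<longrightarrow> trace_module TYPE('a + 'x + 'u) R V Y"
  let ?cyc = "\<forall>Y. cyclic_submodule R V Y \<longrightarrow> trace_module TYPE('a + 'x + 'u) R V Y"
  let ?emb = "\<exists>h\<in>mod_hom R V (direct_sum (Max_spec R) E). inj_on h (carrier V)"
  have "?all \<Longrightarrow> ?cyc"
    using V.cyclic_submodule_submodule by (auto simp: cyclic_submodule_def)
  moreover have "?cyc \<Longrightarrow> annihilator_reflecting R V"
    by (rule cyclic_traces_imp_annihilator_reflecting[OF assms(3)]) blast
  moreover have "annihilator_reflecting R V \<Longrightarrow> ?all"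
    using annihilator_reflecting_imp_trace[OF assms(3) inj] by blast
  moreover have "annihilator_reflecting R V \<longleftrightarrow> ?emb"
    unfolding V.annihilator_reflecting_iff_socle[OF assms(2)]
    using env.socle_imp_embeds[OF assms(2,3) inj E_inj] env.embeds_imp_essential[OF assms(3)]
      env.embeds_imp_multiplicity_free[OF assms(3)] by blast
  ultimately show ?thesis by blast
qed

end
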